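(* Let $K\in\mathcal S^n_o$ and $\varphi\in\Phi$. Then $$V(\mathrm L_\varphi K)\ge V(K),$$ with equality if and only if $K\in\mathcal E^n$.
   Context: Work in $\mathbb R^n$; $V$ is volume, $S$ spherical Lebesgue measure on the unit sphere $S^{n-1}$. $\Phi$ is the class of convex, strictly increasing functions $\varphi:[0,\infty)\to[0,\infty)$ with $\varphi(0)=0$. For a compact set $K$ that is star-shaped about the origin, the radial function is $\rho_K(x)=\sup\{\lambda\ge0:\lambda x\in K\}$, $x\ne o$; $\mathcal S^n_o$ is the class of star bodies about the origin $o$, i.e. compact sets $K$ with $\lambda x\in K$ for all $x\in K,\lambda\in[0,1]$, with $o\in\operatorname{int}K$ and $\rho_K$ continuous on $S^{n-1}$. $\mathcal E^n$ is the class of (nondegenerate, $n$-dimensional) origin-symmetric ellipsoids. $V_K^*$ is the probability measure on $S^{n-1}$ with $dV_K^*=\frac{\rho_K^n}{nV(K)}\,dS$. For $K,L\in\mathcal S^n_o$, $$O_\varphi(K,L)=\inf\left\{\lambda>0:\ \varphi^{-1}\left(\int_{S^{n-1}}\varphi\left(\frac{\rho_K}{\lambda\rho_L}\right)dV_K^*\right)\le1\right\}.$$ The Orlicz-Legendre ellipsoid $\mathrm L_\varphi K$ is the unique $E\in\mathcal E^n$ that minimizes $V(E)$ subject to $O_\varphi(K,E)\le1$ (it exists and is unique). *)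

theory Defs
  imports "HOL-Analysis.Analysis"
begin

definition Phi :: "(real \<Rightarrow> real) set" where
  "Phi = {\<phi>. \<phi> ` {0..} \<subseteq> {0..} \<and> convex_on {0..} \<phi> \<and> strict_mono_on {0..} \<phi> \<and> \<phi> 0 = 0}"

abbreviation vol :: "(real ^ 'n) set \<Rightarrow> real" where
  "vol K \<equiv> measure lebesgue K"

definition radial :: "(real ^ 'n) set \<Rightarrow> real ^ 'n \<Rightarrow> real" where
  "radial K x = Sup {t. 0 \<le> t \<and> t *\<^sub>R x \<in> K}"

definition star_bodies :: "(real ^ 'n) set set" where
  "star_bodies = {K. compact K \<and> (\<forall>x\<in>K. \<forall>t\<in>{0..1}. t *\<^sub>R x \<in> K) \<and>
     0 \<in> interior K \<and> continuous_on (sphere 0 1) (radial K)}"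

definition ellipsoids :: "(real ^ 'n) set set" where
  "ellipsoids = {E. \<exists>f :: real ^ 'n \<Rightarrow> real ^ 'n. linear f \<and> bij f \<and> E = f ` cball 0 1}"

text \<open>Spherical Lebesgue measure, as the cone measure: the measure of a Borel set \<open>A\<close> of unit
  vectors is \<open>n\<close> times the volume of the cone over \<open>A\<close> in the unit ball; see
  \<open>emeasure_sphere_measure\<close> below.\<close>

definition sphere_measure :: "(real ^ 'n) measure" where
  "sphere_measure = scale_measure (of_nat CARD('n))
     (distr (restrict_space lborel (cball 0 1 - {0})) (restrict_space borel (sphere 0 1))
       (\<lambda>x. x /\<^sub>R norm x))"

lemma space_sphere_measure: "space (sphere_measure :: (real ^ 'n) measure) = sphere 0 1"
  by (simp add: sphere_measure_def space_scale_measure space_restrict_space)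

lemma sets_sphere_measure:
  "sets (sphere_measure :: (real ^ 'n) measure) = sets (restrict_space borel (sphere 0 1))"
  by (simp add: sphere_measure_def)

lemma emeasure_sphere_measure:
  fixes A :: "(real ^ 'n) set"
  assumes "A \<in> sets borel" "A \<subseteq> sphere 0 1"
  shows "emeasure sphere_measure A =
    of_nat CARD('n) * emeasure lborel {x. 0 < norm x \<and> norm x \<le> 1 \<and> x /\<^sub>R norm x \<in> A}"
proof -
  let ?B = "cball 0 1 - {0} :: (real ^ 'n) set"
  have "(\<lambda>x. x /\<^sub>R norm x) \<in> restrict_space lborel ?B \<rightarrow>\<^sub>M (borel :: (real ^ 'n) measure)"
    by (intro measurable_restrict_space1) measurable
  then have meas: "(\<lambda>x. x /\<^sub>R norm x) \<in> restrict_space lborel ?B \<rightarrow>\<^sub>M restrict_space borel (sphere 0 1)"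
    by (auto intro!: measurable_restrict_space2 simp: space_restrict_space)
  have A: "A \<in> sets (restrict_space borel (sphere 0 1))"
    using assms by (simp add: sets_restrict_space_iff)
  have eq: "(\<lambda>x. x /\<^sub>R norm x) -` A \<inter> space (restrict_space lborel ?B) =
      {x. 0 < norm x \<and> norm x \<le> 1 \<and> x /\<^sub>R norm x \<in> A}"
    by (auto simp: space_restrict_space)
  show ?thesis
    unfolding sphere_measure_def emeasure_scale_measure emeasure_distr[OF meas A] eq
    by (subst emeasure_restrict_space) auto
qed

definition dual_vol_measure :: "(real ^ 'n) set \<Rightarrow> (real ^ 'n) measure" where
  "dual_vol_measure K =
     density sphere_measure (\<lambda>u. ennreal (radial K u ^ CARD('n) / (real CARD('n) * vol K)))"

definition Orlicz_functional ::
    "(real \<Rightarrow> real) \<Rightarrow> (real ^ 'n) set \<Rightarrow> (real ^ 'n) set \<Rightarrow> real" where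
  "Orlicz_functional \<phi> K L = Inf {t. 0 < t \<and>
     inv_into {0..} \<phi> (\<integral>u. \<phi> (radial K u / (t * radial L u)) \<partial>dual_vol_measure K) \<le> 1}"

definition Orlicz_Legendre :: "(real \<Rightarrow> real) \<Rightarrow> (real ^ 'n) set \<Rightarrow> (real ^ 'n) set" where
  "Orlicz_Legendre \<phi> K =
     (THE E. is_arg_min vol (\<lambda>E. E \<in> ellipsoids \<and> Orlicz_functional \<phi> K E \<le> 1) E)"

end

theory Submission
  imports Defs
begin

text \<open>An ellipsoid is \<open>E = {x. \<bar>A x\<bar> \<le> 1}\<close> with \<open>A\<close> invertible; it is admissible iff
  \<open>G A = \<integral> \<phi> (\<rho>\<^sub>K(u) \<bar>A u\<bar>) dV\<^sub>K\<^sup>* \<le> \<phi> 1\<close>, and its volume is proportional to \<open>1 / \<bar>det A\<bar>\<close>.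

  Since \<open>G\<close> is convex, finite and coercive, \<open>\<bar>det\<bar>\<close> attains its maximum on the admissible set.
  If \<open>A\<close> and \<open>B\<close> are two maximizers, rotate \<open>B\<close> so that \<open>B A\<^sup>-\<^sup>1\<close> is positive definite; then
  the midpoint is admissible and has no smaller determinant, so equality must hold in the triangle
  inequality for \<open>A u\<close> and \<open>B u\<close> for every \<open>u\<close>, which makes \<open>B A\<^sup>-\<^sup>1\<close> a scalar.

  With \<open>y = \<rho>\<^sub>E / \<rho>\<^sub>K\<close>, a supporting line of \<open>\<phi>\<close> at 1 gives \<open>\<integral> 1 / y dV\<^sub>K\<^sup>* \<le> 1\<close> for admissible \<open>E\<close>,
  and Bernoulli's inequality gives \<open>y\<^sup>n \<ge> 1 + n (y - 1) \<ge> 1 + n (1 - 1 / y)\<close>; integrating,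
  \<open>V(E) / V(K) = \<integral> y\<^sup>n dV\<^sub>K\<^sup>* \<ge> 1\<close>, with equality only for \<open>y = 1\<close>.\<close>

section \<open>Singular values and determinants\<close>

lemma matrix_add_rdistrib: "(A + B) ** C = A ** C + B ** (C :: real^'n^'m)"
  by (vector matrix_matrix_mult_def sum.distrib[symmetric] field_simps)

text \<open>A unit vector \<open>x\<close> of \<open>S\<close> maximizing \<open>norm (f x)\<close>
  satisfies a first-order condition: \<open>f x\<close> is orthogonal to \<open>f y\<close> whenever
  \<open>y\<close> in \<open>S\<close> is orthogonal to \<open>x\<close>. The orthogonal complement
  of \<open>x\<close> in \<open>S\<close> then supplies the remaining vectors by induction.\<close>

lemma exists_orthonormal_basis_orthogonal_images:
  fixes f :: "'a::euclidean_space \<Rightarrow> 'b::euclidean_space"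
  assumes f: "linear f" and "subspace S"
  shows "\<exists>B. finite B \<and> B \<subseteq> S \<and> card B = dim S \<and> (\<forall>x\<in>B. norm x = 1) \<and>
           pairwise orthogonal B \<and> pairwise (\<lambda>x y. orthogonal (f x) (f y)) B"
  using \<open>subspace S\<close>
proof (induction "dim S" arbitrary: S)
  case 0
  then show ?case by (intro exI[of _ "{}"]) auto
next
  case (Suc k)
  interpret f: linear f by fact
  have "\<not> S \<subseteq> {0}" using Suc.hyps(2) by (metis dim_eq_0 nat.distinct(1))
  then obtain z where z: "z \<in> S" "z \<noteq> 0" by blast
  then have "z /\<^sub>R norm z \<in> S \<inter> sphere 0 1" using Suc.prems by (simp add: subspace_scale)
  moreover have "compact (S \<inter> sphere 0 1)"
    using closed_subspace[OF Suc.prems] by (simp add: closed_Int_compact)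
  moreover have cf: "continuous_on X f" for X
    using f by (simp add: linear_continuous_on linear_conv_bounded_linear)
  moreover have "continuous_on (S \<inter> sphere 0 1) (\<lambda>x. norm (f x))"
    by (intro continuous_on_norm cf)
  ultimately obtain x where x: "x \<in> S" "norm x = 1"
    and max: "\<And>y. y \<in> S \<Longrightarrow> norm y = 1 \<Longrightarrow> norm (f y) \<le> norm (f x)"
    using continuous_attains_sup[of "S \<inter> sphere 0 1" "\<lambda>x. norm (f x)"]
    by (metis (lifting) Int_iff empty_iff dist_0_norm mem_sphere)
  have bound: "norm (f v) \<le> norm (f x) * norm v" if "v \<in> S" for v
  proof (cases "v = 0")
    case False
    have "norm (f (v /\<^sub>R norm v)) \<le> norm (f x)"
      using that False Suc.prems by (intro max) (auto simp: subspace_scale)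
    then show ?thesis using False by (simp add: f.scaleR field_simps)
  qed (simp add: f.zero)
  have orth: "orthogonal (f x) (f y)" if y: "y \<in> S" "orthogonal x y" for y
  proof -
    define a where "a = f x \<bullet> f y"
    define c where "c = (norm (f x))\<^sup>2 * (norm y)\<^sup>2 - (norm (f y))\<^sup>2"
    \<comment> \<open>This is maximality at \<open>x + t *\<^sub>R y\<close>, squared. A linear term
      in \<open>t\<close> bounded by a quadratic one for all real \<open>t\<close> must
      vanish.\<close>
    have *: "2 * t * a \<le> t\<^sup>2 * c" for t
    proof -
      have "x + t *\<^sub>R y \<in> S" using x y Suc.prems by (simp add: subspace_add subspace_scale)
      from bound[OF this] have "(norm (f (x + t *\<^sub>R y)))\<^sup>2 \<le> (norm (f x))\<^sup>2 * (norm (x + t *\<^sub>R y))\<^sup>2"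
        by (metis norm_ge_zero power_mono power_mult_distrib)
      moreover have "(norm (f (x + t *\<^sub>R y)))\<^sup>2 = (norm (f x))\<^sup>2 + 2 * t * a + t\<^sup>2 * (norm (f y))\<^sup>2"
        unfolding power2_norm_eq_inner f.add f.scaleR a_def
        by (simp add: inner_simps inner_commute algebra_simps power2_eq_square)
      moreover have "(norm (x + t *\<^sub>R y))\<^sup>2 = 1 + t\<^sup>2 * (norm y)\<^sup>2"
        using x y(2) unfolding power2_norm_eq_inner norm_eq_1 orthogonal_def
        by (simp add: inner_simps inner_commute algebra_simps power2_eq_square)
      ultimately show ?thesis by (simp add: c_def algebra_simps)
    qed
    have "a = 0"
    proof (rule ccontr)
      assume "a \<noteq> 0"
      \<comment> \<open>At \<open>t = a / s\<close> the bound reads \<open>2 * s \<le> c\<close>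
        after cancelling \<open>a\<^sup>2\<close>, so any positive \<open>s\<close> with
        \<open>c < 2 * s\<close> refutes it.\<close>
      define s where "s = \<bar>c\<bar> + 1"
      have s: "s > 0" "c < 2 * s" by (auto simp: s_def)
      have "2 * (a / s) * a * s\<^sup>2 \<le> (a / s)\<^sup>2 * c * s\<^sup>2"
        using *[of "a / s"] by (intro mult_right_mono) auto
      then have "a\<^sup>2 * (2 * s) \<le> a\<^sup>2 * c" using s by (simp add: power2_eq_square field_simps)
      then show False using s \<open>a \<noteq> 0\<close> by simp
    qed
    then show ?thesis by (simp add: a_def orthogonal_def)
  qed
  define T where "T = {y \<in> S. \<forall>z\<in>span {x}. orthogonal z y}"
  have "x \<noteq> 0" using x by auto
  then have "dim T + 1 = dim S"
    unfolding T_def using dim_subspace_orthogonal_to_vectors[of "span {x}" S] Suc.prems x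
    by (simp add: span_minimal)
  then have k: "k = dim T" using Suc.hyps(2) by simp
  have "subspace T" using Suc.prems unfolding T_def
    by (auto simp: subspace_def orthogonal_clauses)
  from Suc.hyps(1)[OF k this] obtain B where B: "finite B" "B \<subseteq> T" "card B = dim T"
     "\<forall>x\<in>B. norm x = 1" "pairwise orthogonal B" "pairwise (\<lambda>x y. orthogonal (f x) (f y)) B"
    by blast
  have xT: "orthogonal x y" "y \<in> S" if "y \<in> T" for y
    using that by (auto simp: T_def span_base)
  have "x \<notin> T" using xT(1)[of x] \<open>x \<noteq> 0\<close> by (auto simp: orthogonal_def)
  then have "x \<notin> B" using B by auto
  show ?case
  proof (intro exI[of _ "insert x B"] conjI)
    show "card (insert x B) = dim S" using B \<open>x \<notin> B\<close> k Suc.hyps(2) by simp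
    show "pairwise orthogonal (insert x B)"
      using B xT by (auto simp: pairwise_insert orthogonal_commute)
    show "pairwise (\<lambda>x y. orthogonal (f x) (f y)) (insert x B)"
      using B xT orth by (auto simp: pairwise_insert orthogonal_commute)
  qed (use B x xT in auto)
qed

text \<open>The columns of \<open>V\<close> are an orthonormal basis with orthogonal images under
  \<open>M\<close>, \<open>d\<close> holds the lengths of these images and \<open>C\<close> the
  normalized images; hence \<open>M ** V = C ** D\<close>. Invertibility makes the lengths
  positive.\<close>

lemma singular_value_decomposition:
  fixes M :: "real^'n^'n"
  assumes "invertible M"
  obtains C V :: "real^'n^'n" and d :: "'n \<Rightarrow> real"
  where "orthogonal_matrix C" "orthogonal_matrix V" "\<And>i. d i > 0"
    "M = C ** (\<chi> i j. if i = j then d i else 0) ** transpose V"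
proof -
  obtain B :: "(real^'n) set" where B: "finite B" "card B = CARD('n)" "\<forall>x\<in>B. norm x = 1"
      "pairwise orthogonal B" "pairwise (\<lambda>x y. orthogonal (M *v x) (M *v y)) B"
    using exists_orthonormal_basis_orthogonal_images[OF matrix_vector_mul_linear[of M] subspace_UNIV]
    by auto
  then obtain h where h: "bij_betw h (UNIV :: 'n set) B"
    by (metis finite_class.finite_UNIV finite_same_card_bij)
  then have hB: "h i \<in> B" and h_eq: "h i = h j \<longleftrightarrow> i = j" for i j
    by (auto simp: bij_betw_def inj_eq)
  define d where "d i = norm (M *v h i)" for i
  define V :: "real^'n^'n" where "V = (\<chi> i j. h j $ i)"
  define C :: "real^'n^'n" where "C = (\<chi> i j. (M *v h j) $ i / d j)"
  define D :: "real^'n^'n" where "D = (\<chi> i j. if i = j then d i else 0)"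
  have d: "d i > 0" for i
  proof -
    have "h i \<noteq> 0" using B hB[of i] by force
    then show ?thesis
      using assms unfolding d_def
      by (metis invertible_def matrix_left_invertible_ker zero_less_norm_iff)
  qed
  have colV: "column j V = h j" and colC: "column j C = (M *v h j) /\<^sub>R d j" for j
    by (simp_all add: V_def C_def column_def vec_eq_iff divide_inverse mult.commute)
  have V: "orthogonal_matrix V"
    unfolding orthogonal_matrix_orthonormal_columns colV
    using B hB h_eq by (auto simp: pairwise_def)
  have C: "orthogonal_matrix C"
    unfolding orthogonal_matrix_orthonormal_columns colC
    using B hB h_eq d by (auto simp: pairwise_def orthogonal_clauses d_def dest!: less_imp_neq)
  have "M ** V = C ** D"
    using d by (auto simp: V_def C_def D_def vec_eq_iff matrix_matrix_mult_def matrix_vector_mult_def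
        if_distrib less_imp_neq[THEN not_sym] cong: if_cong)
  then have "M = C ** D ** transpose V"
    using V by (metis matrix_mul_assoc matrix_mul_rid orthogonal_matrix_def)
  with that C V d show ?thesis unfolding D_def by blast
qed

text \<open>The rotation \<open>Q\<close> turns \<open>B A\<^sup>-\<^sup>1\<close> into its positive definite polar factor; its eigenvalues
  \<open>d i\<close> have product 1 and satisfy \<open>1 + d i \<ge> 2 \<surd>d i\<close>.\<close>

lemma exists_rotation_det_add_ge:
  fixes A B :: "real^'n^'n"
  assumes "invertible A" "invertible B" and eq: "\<bar>det B\<bar> = \<bar>det A\<bar>"
  shows "\<exists>Q. orthogonal_matrix Q \<and> 2 ^ CARD('n) * \<bar>det A\<bar> \<le> \<bar>det (A + Q ** B)\<bar>"
proof -
  obtain A' where A': "A ** A' = mat 1" "A' ** A = mat 1"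
    using \<open>invertible A\<close> by (auto simp: invertible_def)
  define M where "M = B ** A'"
  have MA: "M ** A = B" by (simp add: M_def A' matrix_mul_assoc[symmetric])
  have detA: "det A \<noteq> 0" using \<open>invertible A\<close> invertible_det_nz by blast
  have detM: "\<bar>det M\<bar> = 1" using eq detA
    by (simp flip: MA add: det_mul abs_mult)
  then have "invertible M" by (auto simp: invertible_det_nz)
  then obtain C V d where CV: "orthogonal_matrix C" "orthogonal_matrix V" "\<And>i. d i > 0"
    and M: "M = C ** (\<chi> i j. if i = j then d i else 0) ** transpose V"
    by (rule singular_value_decomposition) blast
  define D :: "real^'n^'n" where "D = (\<chi> i j. if i = j then d i else 0)"
  have detV: "\<bar>det V\<bar> = 1" and detC: "\<bar>det C\<bar> = 1"
    using CV det_orthogonal_matrix by fastforce+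
  have "det D = (\<Prod>i\<in>UNIV. d i)" by (simp add: det_diagonal D_def)
  then have prod: "(\<Prod>i\<in>UNIV. d i) = 1"
    using detM detV detC prod_pos[of UNIV d] CV(3) by (simp add: M det_mul abs_mult flip: D_def)
  \<comment> \<open>Cancelling \<open>transpose C ** C\<close> leaves
    \<open>Q ** M = V ** D ** transpose V\<close>, which is symmetric and positive definite.\<close>
  define Q where "Q = V ** transpose C"
  have "Q ** M = V ** D ** transpose V"
    using CV(1) unfolding Q_def M D_def[symmetric]
    by (metis matrix_mul_assoc matrix_mul_rid orthogonal_matrix)
  moreover have "V ** (mat 1 + D) ** transpose V = mat 1 + V ** D ** transpose V"
    using CV(2) by (simp add: matrix_add_ldistrib matrix_add_rdistrib orthogonal_matrix_def)
  ultimately have "A + Q ** B = V ** (mat 1 + D) ** transpose V ** A"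
    by (simp add: matrix_add_rdistrib MA matrix_mul_assoc flip: MA)
  then have "\<bar>det (A + Q ** B)\<bar> = \<bar>det (mat 1 + D)\<bar> * \<bar>det A\<bar>"
    using detV by (simp add: det_mul abs_mult)
  moreover have "det (mat 1 + D) = (\<Prod>i\<in>UNIV. 1 + d i)"
    by (subst det_diagonal) (auto simp: D_def mat_def)
  moreover have "2 ^ CARD('n) \<le> (\<Prod>i\<in>UNIV. 1 + d i)"
  \<comment> \<open>Comparing squares avoids the roots of \<open>d i\<close>: both sides are
    products, and each factor satisfies \<open>4 * d i \<le> (1 + d i)\<^sup>2\<close>.\<close>
  proof (rule power2_le_imp_le)
    have "(2 ^ CARD('n))\<^sup>2 = (\<Prod>i\<in>(UNIV::'n set). 4 * d i)"
      by (simp add: prod.distrib prod power_mult[symmetric] power2_eq_square power_mult_distrib[symmetric])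
    also have "\<dots> \<le> (\<Prod>i\<in>UNIV. (1 + d i)\<^sup>2)"
    proof (rule prod_mono)
      fix i
      have "0 \<le> (1 - d i)\<^sup>2" by simp
      then have "4 * d i \<le> (1 + d i)\<^sup>2" by (simp add: power2_eq_square algebra_simps)
      then show "0 \<le> 4 * d i \<and> 4 * d i \<le> (1 + d i)\<^sup>2" using CV(3)[of i] by simp
    qed
    finally show "(2 ^ CARD('n))\<^sup>2 \<le> (\<Prod>i\<in>UNIV. 1 + d i)\<^sup>2" by (simp add: prod_power_distrib)
  qed (auto intro!: prod_nonneg less_imp_le[OF add_pos_pos] CV(3))
  moreover have "orthogonal_matrix Q"
    using CV by (simp add: Q_def orthogonal_matrix_mul orthogonal_matrix_transpose)
  ultimately show ?thesis
    by (intro exI[of _ Q]) (auto intro!: mult_right_mono)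
qed

section \<open>Volumes of ellipsoids\<close>

text \<open>Uniqueness of Haar measure by Fubini's theorem: \<open>f\<close> maps the unit ball onto itself, so the
  image of \<open>lborel\<close> is translation invariant with the same value on the ball.\<close>

lemma distr_lborel_orthogonal_transformation:
  fixes f :: "'a::euclidean_space \<Rightarrow> 'a"
  assumes f: "orthogonal_transformation f"
  shows "distr lborel borel f = lborel"
proof (rule measure_eqI)
  show "sets (distr lborel borel f) = sets lborel" by simp
  fix A assume "A \<in> sets (distr lborel borel f)"
  then have A[measurable]: "A \<in> sets borel" by simp
  let ?g = "indicator (cball (0::'a) 1) :: 'a \<Rightarrow> ennreal"
  let ?A = "indicator A :: 'a \<Rightarrow> ennreal"
  have [measurable]: "?g \<in> borel_measurable borel"
    by (intro borel_measurable_indicator borel_closed closed_cball)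
  interpret f: linear f using f by (rule orthogonal_transformation_linear)
  have [measurable]: "f \<in> borel_measurable borel"
    using f.linear_axioms linear_continuous_on linear_conv_bounded_linear
    by (blast intro: borel_measurable_continuous_onI)
  have shift: "(\<integral>\<^sup>+z. h (z + c) \<partial>lborel) = (\<integral>\<^sup>+z. h z \<partial>lborel)"
    if [measurable]: "h \<in> borel_measurable borel" for h :: "'a \<Rightarrow> ennreal" and c
    by (subst (2) lborel_distr_plus[of c, symmetric]) (simp add: nn_integral_distr add.commute)
  have ball: "(\<integral>\<^sup>+x. ?g (y - x) \<partial>lborel) = emeasure lborel (cball (0::'a) 1)" for y
  proof -
    have "(\<integral>\<^sup>+x. ?g (y - x) \<partial>lborel) = (\<integral>\<^sup>+x. ?g (x + - y) \<partial>lborel)"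
      by (intro nn_integral_cong) (auto simp: indicator_def norm_minus_commute)
    also have "\<dots> = emeasure lborel (cball (0::'a) 1)"
      by (subst shift) auto
    finally show ?thesis .
  qed
  \<comment> \<open>The double integral of the indicators of \<open>A\<close> at
    \<open>x + f z\<close> and of the ball at \<open>f z\<close> is evaluated in two ways.
    Integrating over \<open>x\<close> first gives the measure of \<open>A\<close> times that of the
    ball; shifting \<open>z\<close> first gives the measure of the preimage of \<open>A\<close>
    times that of the ball.\<close>
  have "emeasure lborel A * emeasure lborel (cball (0::'a) 1) = (\<integral>\<^sup>+z. emeasure lborel A * ?g (f z) \<partial>lborel)"
    using f by (subst nn_integral_cmult) (auto simp: indicator_def orthogonal_transformation_norm
        nn_integral_indicator[symmetric] simp del: nn_integral_indicator intro!: nn_integral_cong)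
  also have "\<dots> = (\<integral>\<^sup>+z. (\<integral>\<^sup>+x. ?A (x + f z) * ?g (f z) \<partial>lborel) \<partial>lborel)"
    by (intro nn_integral_cong, subst nn_integral_multc) (auto simp: shift)
  also have "\<dots> = (\<integral>\<^sup>+x. (\<integral>\<^sup>+z. ?A (x + f z) * ?g (f z) \<partial>lborel) \<partial>lborel)"
    by (rule lborel_pair.Fubini') measurable
  also have "\<dots> = (\<integral>\<^sup>+x. (\<integral>\<^sup>+z. ?A (f z) * ?g (f z - x) \<partial>lborel) \<partial>lborel)"
  proof (rule nn_integral_cong)
    fix x
    \<comment> \<open>Since \<open>f\<close> is linear and onto, the translation by \<open>x\<close>
      in the image is the translation by \<open>w\<close> in the variable \<open>z\<close>.\<close>
    obtain w where w: "f w = x"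
      using orthogonal_transformation_surj[OF f] by (metis surj_f_inv_f)
    have "(\<lambda>z. ?A (f z) * ?g (f z - x)) \<in> borel_measurable borel" by measurable
    from shift[OF this, of w]
    show "(\<integral>\<^sup>+z. ?A (x + f z) * ?g (f z) \<partial>lborel) = (\<integral>\<^sup>+z. ?A (f z) * ?g (f z - x) \<partial>lborel)"
      by (simp add: f.add w add.commute)
  qed
  also have "\<dots> = (\<integral>\<^sup>+z. (\<integral>\<^sup>+x. ?A (f z) * ?g (f z - x) \<partial>lborel) \<partial>lborel)"
    by (rule lborel_pair.Fubini') measurable
  also have "\<dots> = emeasure (distr lborel borel f) A * emeasure lborel (cball (0::'a) 1)"
    by (subst nn_integral_cmult, measurable)
       (simp add: ball nn_integral_multc emeasure_distr nn_integral_indicator[symmetric]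
          nn_integral_distr del: nn_integral_indicator)
  finally have "emeasure (distr lborel borel f) A * emeasure lborel (cball (0::'a) 1)
      = emeasure lborel A * emeasure lborel (cball (0::'a) 1)" by simp
  moreover have "emeasure lborel (cball (0::'a) 1) < \<infinity>" by (rule emeasure_lborel_cball_finite)
  moreover have "emeasure lborel (cball (0::'a) 1) \<noteq> 0"
    by (simp add: emeasure_cball unit_ball_vol_pos ennreal_eq_0_iff not_le)
  ultimately show "emeasure (distr lborel borel f) A = emeasure lborel A"
    by (auto simp add: mult.commute[of _ "emeasure lborel (cball 0 1)"] ennreal_mult_cancel_left less_top)
qed

lemma measure_lebesgue_eq_lborel: "compact S \<Longrightarrow> measure lebesgue S = measure lborel S"
  by (simp add: borel_compact)

lemma measure_orthogonal_image_compact: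
  fixes f :: "'a::euclidean_space \<Rightarrow> 'a"
  assumes f: "orthogonal_transformation f" and S: "compact S"
  shows "measure lebesgue (f ` S) = measure lebesgue S"
proof -
  have lin: "linear f" using f by (rule orthogonal_transformation_linear)
  have cf: "continuous_on X f" for X
    using lin linear_continuous_on linear_conv_bounded_linear by blast
  have [measurable]: "f \<in> borel_measurable borel"
    using cf by (rule borel_measurable_continuous_onI)
  have fS: "compact (f ` S)" using cf S by (rule compact_continuous_image)
  have "measure (distr lborel borel f) (f ` S) = measure lborel (f -` f ` S \<inter> space lborel)"
    by (rule measure_distr) (use fS in \<open>auto simp: borel_compact\<close>)
  also have "f -` f ` S \<inter> space lborel = S"
    using orthogonal_transformation_inj[OF f] by (simp add: inj_vimage_image_eq)
  finally show ?thesis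
    unfolding distr_lborel_orthogonal_transformation[OF f]
    using S fS by (simp add: measure_lebesgue_eq_lborel)
qed

text \<open>In the singular value decomposition the inner rotation fixes the ball, the diagonal
  factor multiplies volume by the product of the singular values, and the outer rotation preserves
  volume.\<close>

lemma measure_invertible_image_cball:
  fixes M :: "real^'n^'n"
  assumes "invertible M"
  shows "vol ((*v) M ` cball 0 1) = \<bar>det M\<bar> * vol (cball (0::real^'n) 1)"
proof -
  obtain C V :: "real^'n^'n" and d where CV: "orthogonal_matrix C" "orthogonal_matrix V" "\<And>i. d i > 0"
    and M: "M = C ** (\<chi> i j. if i = j then d i else 0) ** transpose V"
    using assms by (rule singular_value_decomposition) blast
  define D :: "real^'n^'n" where "D = (\<chi> i j. if i = j then d i else 0)"
  have "\<bar>det V\<bar> = 1" and "\<bar>det C\<bar> = 1"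
    using CV det_orthogonal_matrix by fastforce+
  then have det: "\<bar>det M\<bar> = \<bar>prod d UNIV\<bar>"
    by (simp add: M det_mul abs_mult det_diagonal)
  have orth: "orthogonal_transformation ((*v) C)" "orthogonal_transformation ((*v) (transpose V))"
    using CV by (simp_all add: orthogonal_transformation_matrix orthogonal_matrix_transpose)
  have "(*v) M ` cball 0 1 = (*v) C ` (*v) D ` (*v) (transpose V) ` cball 0 1"
    by (simp only: M D_def[symmetric] image_image matrix_vector_mul_assoc matrix_mul_assoc)
  also have "\<dots> = (*v) C ` (*v) D ` cball 0 1"
    by (simp only: image_orthogonal_transformation_cball[OF orth(2)] matrix_vector_mult_0_right)
  also have "vol \<dots> = vol ((*v) D ` cball 0 1)"
    by (intro measure_orthogonal_image_compact orth compact_continuous_image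
        matrix_vector_mult_linear_continuous_on compact_cball)
  also have "(*v) D = (\<lambda>x. \<chi> k. d k * x $ k)"
    by (auto simp: fun_eq_iff vec_eq_iff D_def matrix_vector_mult_def if_distrib if_distribR cong: if_cong)
  also have "vol (\<dots> ` cball 0 1) = \<bar>prod d UNIV\<bar> * vol (cball (0::real^'n) 1)"
    by (rule measure_stretch) simp
  finally show ?thesis by (simp add: det)
qed

section \<open>Star bodies in polar coordinates\<close>

lemma normalize_mem_sphere: "x \<noteq> 0 \<Longrightarrow> x /\<^sub>R norm x \<in> sphere 0 (1::real)"
  for x :: "'a::real_normed_vector"
  by simp

text \<open>Dilation by \<open>c\<close> preserves directions, so this is the homogeneity of
  Lebesgue measure.\<close>

lemma emeasure_lborel_cone_scale:
  fixes A :: "'a::euclidean_space set"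
  assumes [measurable]: "A \<in> sets borel" and c: "c > 0"
  shows "emeasure lborel {x. x \<noteq> 0 \<and> norm x < c \<and> x /\<^sub>R norm x \<in> A} =
    ennreal c ^ DIM('a) * emeasure lborel {x. x \<noteq> 0 \<and> norm x < 1 \<and> x /\<^sub>R norm x \<in> A}"
    (is "emeasure lborel ?S = _")
proof -
  have [measurable]: "?S \<in> sets borel" by measurable
  have cancel: "inverse c * r * c = r" for r using c by simp
  have eq: "(\<lambda>x. 0 + c *\<^sub>R x) -` ?S = {x. x \<noteq> 0 \<and> norm x < 1 \<and> x /\<^sub>R norm x \<in> A}"
    using c by (auto simp: cancel)
  have "emeasure lborel ?S =
      emeasure (density (distr lborel borel (\<lambda>x::'a. 0 + c *\<^sub>R x)) (\<lambda>_. ennreal (\<bar>c\<bar> ^ DIM('a)))) ?S"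
    using c by (subst lborel_affine[of c 0, symmetric]) auto
  also have "\<dots> = ennreal (\<bar>c\<bar> ^ DIM('a)) * emeasure lborel ((\<lambda>x. 0 + c *\<^sub>R x) -` ?S)"
    by (subst emeasure_density) (simp_all add: nn_integral_cmult emeasure_distr)
  finally show ?thesis unfolding eq using c by (simp add: ennreal_power)
qed

lemma AE_lborel_norm_neq_1: "AE x in lborel. norm (x :: 'a::euclidean_space) \<noteq> 1"
proof -
  have "sphere (0::'a) 1 \<in> null_sets lborel"
    using negligible_sphere[of "0::'a" 1]
    by (simp add: negligible_iff_null_sets null_sets_completion_iff borel_closed)
  from AE_not_in[OF this] show ?thesis by simp
qed

lemma tendsto_power_ennreal:
  fixes f :: "'a \<Rightarrow> ennreal"
  assumes "(f \<longlongrightarrow> l) F" "l \<noteq> top"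
  shows "((\<lambda>x. f x ^ n) \<longlongrightarrow> l ^ n) F"
proof (induction n)
  case (Suc n)
  then show ?case using assms by (simp, intro tendsto_mult_ennreal) (auto simp: power_eq_top_ennreal)
qed simp

text \<open>Polar coordinates for a region whose radial function takes finitely many values: on each
  level set of \<open>s\<close> the region is a cone of constant radius, to which the scaling of
  cones applies.\<close>

lemma emeasure_radial_simple:
  fixes s :: "'a::euclidean_space \<Rightarrow> ennreal"
  assumes s: "simple_function borel s" and fin: "\<And>u. s u < top"
  shows "emeasure lborel {x. x \<noteq> 0 \<and> ennreal (norm x) < s (x /\<^sub>R norm x)} =
    (\<integral>\<^sup>+x. s (x /\<^sub>R norm x) ^ DIM('a) * indicator (cball 0 1 - {0}) x \<partial>lborel)"
proof -
  have [measurable]: "s \<in> borel_measurable borel" using s by (rule borel_measurable_simple_function)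
  have finite: "finite (range s)" using simple_functionD(1)[OF s] by simp
  have *: "(\<integral>\<^sup>+x. indicator {x. x \<noteq> 0 \<and> ennreal (norm x) < c \<and> s (x /\<^sub>R norm x) = c} x \<partial>lborel) =
     (\<integral>\<^sup>+x. c ^ DIM('a) * indicator {x. x \<noteq> 0 \<and> norm x \<le> 1 \<and> s (x /\<^sub>R norm x) = c} x \<partial>lborel)" (is "?l = ?r")
    if "c \<in> range s" for c
  proof -
    have "c \<noteq> top" using fin that by (metis imageE less_irrefl)
    then obtain r where r: "c = ennreal r" "r \<ge> 0" by (cases c) auto
    show ?thesis
    proof (cases "r = 0")
      case True then show ?thesis using r by (simp add: power_0_left)
    next
      case False
      with r have "r > 0" by simp
      let ?A = "{u. s u = c}"
      have "?l = emeasure lborel {x. x \<noteq> 0 \<and> norm x < r \<and> x /\<^sub>R norm x \<in> ?A}"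
        by (subst nn_integral_indicator) (auto simp: r ennreal_less_iff intro!: arg_cong[where f="emeasure lborel"])
      also have "\<dots> = c ^ DIM('a) * emeasure lborel {x. x \<noteq> 0 \<and> norm x < 1 \<and> x /\<^sub>R norm x \<in> ?A}"
        using emeasure_lborel_cone_scale[of ?A r] \<open>r > 0\<close> r by simp
      also have "emeasure lborel {x. x \<noteq> 0 \<and> norm x < 1 \<and> x /\<^sub>R norm x \<in> ?A} =
          emeasure lborel {x. x \<noteq> 0 \<and> norm x \<le> 1 \<and> s (x /\<^sub>R norm x) = c}"
        \<comment> \<open>The two cones differ only by a subset of the unit sphere, which is
          null.\<close>
        by (rule emeasure_eq_AE) (use AE_lborel_norm_neq_1 in \<open>auto elim!: eventually_mono\<close>)
      finally show ?thesis by (simp add: nn_integral_cmult)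
    qed
  qed
  have "emeasure lborel {x. x \<noteq> 0 \<and> ennreal (norm x) < s (x /\<^sub>R norm x)} =
      (\<integral>\<^sup>+x. indicator {x. x \<noteq> 0 \<and> ennreal (norm x) < s (x /\<^sub>R norm x)} x \<partial>lborel)"
    by (rule nn_integral_indicator[symmetric]) measurable
  also have "\<dots> = (\<integral>\<^sup>+x. (\<Sum>c\<in>range s. indicator {x. x \<noteq> 0 \<and> ennreal (norm x) < c \<and> s (x /\<^sub>R norm x) = c} x) \<partial>lborel)"
  proof (rule nn_integral_cong)
    fix x :: 'a
    have "(\<Sum>c\<in>range s. indicator {x. x \<noteq> 0 \<and> ennreal (norm x) < c \<and> s (x /\<^sub>R norm x) = c} x :: ennreal)
      = (\<Sum>c\<in>range s. if c = s (x /\<^sub>R norm x) then indicator {x. x \<noteq> 0 \<and> ennreal (norm x) < s (x /\<^sub>R norm x)} x else 0)"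
      by (rule sum.cong) (auto simp: indicator_def)
    then show "(indicator {x. x \<noteq> 0 \<and> ennreal (norm x) < s (x /\<^sub>R norm x)} x :: ennreal) =
      (\<Sum>c\<in>range s. indicator {x. x \<noteq> 0 \<and> ennreal (norm x) < c \<and> s (x /\<^sub>R norm x) = c} x)"
      using finite by simp
  qed
  also have "\<dots> = (\<Sum>c\<in>range s. \<integral>\<^sup>+x. indicator {x. x \<noteq> 0 \<and> ennreal (norm x) < c \<and> s (x /\<^sub>R norm x) = c} x \<partial>lborel)"
    by (rule nn_integral_sum) measurable
  also have "\<dots> = (\<Sum>c\<in>range s. \<integral>\<^sup>+x. c ^ DIM('a) * indicator {x. x \<noteq> 0 \<and> norm x \<le> 1 \<and> s (x /\<^sub>R norm x) = c} x \<partial>lborel)"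
    using * by (rule sum.cong[OF refl])
  also have "\<dots> = (\<integral>\<^sup>+x. (\<Sum>c\<in>range s. c ^ DIM('a) * indicator {x. x \<noteq> 0 \<and> norm x \<le> 1 \<and> s (x /\<^sub>R norm x) = c} x) \<partial>lborel)"
    by (rule nn_integral_sum[symmetric]) measurable
  also have "\<dots> = (\<integral>\<^sup>+x. s (x /\<^sub>R norm x) ^ DIM('a) * indicator (cball 0 1 - {0}) x \<partial>lborel)"
  proof (rule nn_integral_cong)
    fix x :: 'a
    have "(\<Sum>c\<in>range s. c ^ DIM('a) * indicator {x. x \<noteq> 0 \<and> norm x \<le> 1 \<and> s (x /\<^sub>R norm x) = c} x)
      = (\<Sum>c\<in>range s. if c = s (x /\<^sub>R norm x) then c ^ DIM('a) * indicator (cball 0 1 - {0}) x else 0)"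
      by (rule sum.cong) (auto simp: indicator_def)
    then show "(\<Sum>c\<in>range s. c ^ DIM('a) * indicator {x. x \<noteq> 0 \<and> norm x \<le> 1 \<and> s (x /\<^sub>R norm x) = c} x)
      = s (x /\<^sub>R norm x) ^ DIM('a) * indicator (cball 0 1 - {0}) x"
      using finite by simp
  qed
  finally show ?thesis .
qed

text \<open>Monotone approximation of \<open>f\<close> by simple functions; both sides pass to the
  limit.\<close>

lemma emeasure_radial:
  fixes f :: "'a::euclidean_space \<Rightarrow> ennreal"
  assumes [measurable]: "f \<in> borel_measurable borel" and fin: "\<And>u. f u < top"
  shows "emeasure lborel {x. x \<noteq> 0 \<and> ennreal (norm x) < f (x /\<^sub>R norm x)} =
    (\<integral>\<^sup>+x. f (x /\<^sub>R norm x) ^ DIM('a) * indicator (cball 0 1 - {0}) x \<partial>lborel)"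
proof -
  obtain s where s: "\<And>i. simple_function borel (s i)" "incseq s" "\<And>i x. s i x < top" "\<And>x. (SUP i. s i x) = f x"
    using borel_measurable_implies_simple_function_sequence'[OF assms(1)] by blast
  have [measurable]: "s i \<in> borel_measurable borel" for i
    using s(1) by (rule borel_measurable_simple_function)
  have [measurable]: "cball (0::'a) 1 \<in> sets borel" "{0::'a} \<in> sets borel" by auto
  have inc: "incseq (\<lambda>i. s i u)" for u using s(2) by (auto simp: incseq_def le_fun_def)
  define S where "S i = {x. x \<noteq> 0 \<and> ennreal (norm x) < s i (x /\<^sub>R norm x)}" for i
  have [measurable]: "S i \<in> sets borel" for i unfolding S_def by measurable
  have "(\<lambda>i. emeasure lborel (S i)) \<longlonglongrightarrow> emeasure lborel (\<Union>i. S i)"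
  proof (rule Lim_emeasure_incseq)
    show "incseq S" unfolding incseq_def S_def
    proof (intro allI impI subsetI)
      fix m n x assume "(m::nat) \<le> n" "x \<in> {x. x \<noteq> 0 \<and> ennreal (norm x) < s m (x /\<^sub>R norm x)}"
      then show "x \<in> {x. x \<noteq> 0 \<and> ennreal (norm x) < s n (x /\<^sub>R norm x)}"
        using incseqD[OF inc[of "x /\<^sub>R norm x"], of m n] by auto
    qed
  qed auto
  \<comment> \<open>The strict inequality matters: \<open>norm x\<close> lies below a supremum iff
    it lies below some term, whereas equality could be reached only in the limit.\<close>
  also have "(\<Union>i. S i) = {x. x \<noteq> 0 \<and> ennreal (norm x) < f (x /\<^sub>R norm x)}"
    by (auto simp: S_def less_SUP_iff simp flip: s(4))
  finally have 1: "(\<lambda>i. emeasure lborel (S i)) \<longlonglongrightarrow> emeasure lborel {x. x \<noteq> 0 \<and> ennreal (norm x) < f (x /\<^sub>R norm x)}" .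
  have 2: "(\<lambda>i. \<integral>\<^sup>+x. s i (x /\<^sub>R norm x) ^ DIM('a) * indicator (cball 0 1 - {0}) x \<partial>lborel)
     \<longlonglongrightarrow> (\<integral>\<^sup>+x. f (x /\<^sub>R norm x) ^ DIM('a) * indicator (cball 0 1 - {0}) x \<partial>lborel)"
  proof (rule nn_integral_LIMSEQ)
    show "incseq (\<lambda>i x. s i (x /\<^sub>R norm x) ^ DIM('a) * indicator (cball 0 1 - {0}) x)"
      unfolding incseq_def le_fun_def
      by (intro allI impI mult_right_mono power_mono incseqD[OF inc]) auto
    show "(\<lambda>i. s i (x /\<^sub>R norm x) ^ DIM('a) * indicator (cball 0 1 - {0}) x)
      \<longlonglongrightarrow> f (x /\<^sub>R norm x) ^ DIM('a) * indicator (cball 0 1 - {0}) x" for x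
    proof -
      have "(\<lambda>i. s i (x /\<^sub>R norm x)) \<longlonglongrightarrow> f (x /\<^sub>R norm x)"
        unfolding s(4)[symmetric] by (rule LIMSEQ_SUP[OF inc])
      then have "(\<lambda>i. s i (x /\<^sub>R norm x) ^ DIM('a)) \<longlonglongrightarrow> f (x /\<^sub>R norm x) ^ DIM('a)"
        by (rule tendsto_power_ennreal) (use fin in \<open>simp add: less_top\<close>)
      then show ?thesis by (cases "x \<in> cball 0 1 - {0}") (auto simp: indicator_def)
    qed
  qed measurable
  show ?thesis
    using 1 2 unfolding S_def emeasure_radial_simple[OF s(1,3)] by (rule LIMSEQ_unique)
qed

section \<open>Radial functions of star bodies and the polar formula for their volume\<close>

lemma compact_star_body: "K \<in> star_bodies \<Longrightarrow> compact K"
  by (simp add: star_bodies_def)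

lemma continuous_on_radial: "K \<in> star_bodies \<Longrightarrow> continuous_on (sphere 0 1) (radial K)"
  by (simp add: star_bodies_def)

lemma zero_in_star_body: "K \<in> star_bodies \<Longrightarrow> 0 \<in> K"
  using interior_subset by (auto simp: star_bodies_def)

text \<open>Along the ray through \<open>u\<close> the body cuts out a closed bounded set of
  parameters, so the supremum is attained; star-shapedness fills in everything below it, and an
  interior ball makes it positive.\<close>

lemma radial_pos_mem_iff:
  fixes K :: "(real^'n) set"
  assumes K: "K \<in> star_bodies" and u: "norm u = 1"
  shows radial_pos: "0 < radial K u"
    and mem_star_body_iff: "\<And>t. 0 \<le> t \<Longrightarrow> t *\<^sub>R u \<in> K \<longleftrightarrow> t \<le> radial K u"
proof -
  define T where "T = {t. 0 \<le> t \<and> t *\<^sub>R u \<in> K}"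
  have sup: "radial K u = Sup T" by (simp add: radial_def T_def)
  obtain M where M: "\<And>x. x \<in> K \<Longrightarrow> norm x \<le> M"
    using compact_imp_bounded[OF compact_star_body[OF K]] by (auto simp: bounded_iff)
  have bdd: "bdd_above T"
  proof (rule bdd_aboveI)
    fix t assume "t \<in> T" then show "t \<le> M" using M[of "t *\<^sub>R u"] u by (auto simp: T_def)
  qed
  have "T = {0..} \<inter> (\<lambda>t. t *\<^sub>R u) -` K" by (auto simp: T_def)
  moreover have "closed ((\<lambda>t. t *\<^sub>R u) -` K)"
    using compact_imp_closed[OF compact_star_body[OF K]]
    by (intro closed_vimage) (auto intro!: continuous_intros)
  ultimately have "closed T" by (simp add: closed_Int)
  moreover have "0 \<in> T" using zero_in_star_body[OF K] by (simp add: T_def)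
  ultimately have Sup: "Sup T \<in> T" using closed_contains_Sup bdd by blast
  obtain e where e: "e > 0" "ball 0 e \<subseteq> K"
    using K by (auto simp: star_bodies_def mem_interior)
  have "e / 2 \<in> T" using e u by (auto simp: T_def subset_iff)
  then have "e / 2 \<le> Sup T" using bdd by (rule cSup_upper)
  with e show pos: "0 < radial K u" unfolding sup by linarith
  fix t :: real assume t: "0 \<le> t"
  show "t *\<^sub>R u \<in> K \<longleftrightarrow> t \<le> radial K u"
  proof
    assume "t *\<^sub>R u \<in> K"
    with t show "t \<le> radial K u" unfolding sup by (intro cSup_upper bdd) (simp add: T_def)
  next
    assume le: "t \<le> radial K u"
    have "(t / Sup T) *\<^sub>R (Sup T *\<^sub>R u) \<in> K"
      using K Sup le t pos unfolding sup star_bodies_def T_def by (auto simp del: scaleR_scaleR)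
    then show "t *\<^sub>R u \<in> K" using pos by (simp add: sup)
  qed
qed

lemma mem_star_body_iff_norm:
  fixes K :: "(real^'n) set"
  assumes K: "K \<in> star_bodies" and x: "x \<noteq> 0"
  shows "x \<in> K \<longleftrightarrow> norm x \<le> radial K (x /\<^sub>R norm x)"
  using mem_star_body_iff[OF K, of "x /\<^sub>R norm x" "norm x"] x by simp

lemma star_body_eqI:
  fixes K :: "(real^'n) set"
  assumes "K \<in> star_bodies" "L \<in> star_bodies" "\<And>u. norm u = 1 \<Longrightarrow> radial K u = radial L u"
  shows "K = L"
proof (rule set_eqI)
  fix x show "x \<in> K \<longleftrightarrow> x \<in> L"
    using assms by (cases "x = 0") (auto simp: zero_in_star_body mem_star_body_iff_norm)
qed

lemma borel_measurable_on_sphere: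
  assumes "continuous_on (sphere 0 1) f"
  shows "f \<in> borel_measurable (sphere_measure :: (real^'n) measure)"
  using borel_measurable_continuous_on_restrict[OF assms]
  by (simp cong: measurable_cong_sets add: sets_sphere_measure)

lemma nn_integral_sphere_measure:
  assumes f: "f \<in> borel_measurable (sphere_measure :: (real^'n) measure)"
  shows "(\<integral>\<^sup>+u. f u \<partial>sphere_measure) =
    of_nat CARD('n) * (\<integral>\<^sup>+x. f (x /\<^sub>R norm x) * indicator (cball 0 1 - {0}) x \<partial>lborel)"
proof -
  let ?B = "cball 0 1 - {0} :: (real ^ 'n) set"
  have f': "f \<in> borel_measurable (restrict_space borel (sphere 0 1))"
    using f by (simp cong: measurable_cong_sets add: sets_sphere_measure)
  have "(\<lambda>x. x /\<^sub>R norm x) \<in> restrict_space lborel ?B \<rightarrow>\<^sub>M (borel :: (real ^ 'n) measure)"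
    by (intro measurable_restrict_space1) measurable
  then have meas: "(\<lambda>x. x /\<^sub>R norm x) \<in> restrict_space lborel ?B \<rightarrow>\<^sub>M restrict_space borel (sphere 0 1)"
    by (auto intro!: measurable_restrict_space2 simp: space_restrict_space)
  show ?thesis
    unfolding sphere_measure_def
    by (subst nn_integral_scale_measure)
      (simp_all add: f' nn_integral_distr[OF meas] nn_integral_restrict_space cong: measurable_cong_sets)
qed

text \<open>Up to its boundary and the origin, \<open>K\<close> is the region
  \<open>norm x < radial K (x /\<^sub>R norm x)\<close>, so \<open>emeasure_radial\<close> applies
  once the boundary is known to be null.\<close>

lemma nn_integral_radial_power:
  fixes K :: "(real^'n) set"
  assumes K: "K \<in> star_bodies"
  shows "(\<integral>\<^sup>+u. ennreal (radial K u ^ CARD('n)) \<partial>sphere_measure) = of_nat CARD('n) * emeasure lborel K"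
proof -
  let ?B = "cball 0 1 - {0} :: (real ^ 'n) set"
  \<comment> \<open>\<open>radial K\<close> is known to be continuous only on the sphere; extending
    it by 0 gives a Borel function on the whole space.\<close>
  define f where "f u = ennreal (indicator (sphere 0 1) u *\<^sub>R radial K u)" for u :: "real^'n"
  have [measurable]: "f \<in> borel_measurable borel" unfolding f_def
    by (intro measurable_compose[OF _ measurable_ennreal] borel_measurable_continuous_on_indicator
        continuous_on_radial K borel_closed closed_sphere)
  have [measurable]: "K \<in> sets borel" using compact_star_body[OF K] by (rule borel_compact)
  define N where "N = (\<lambda>u. radial K u *\<^sub>R u) ` sphere 0 1"
  have "compact N" unfolding N_def
    by (intro compact_continuous_image continuous_intros continuous_on_radial K compact_sphere)
  \<comment> \<open>Every ray from the origin meets the boundary \<open>N\<close> exactly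
    once.\<close>
  have "negligible N"
  proof (rule starlike_negligible[of N 0])
    show "closed N" using \<open>compact N\<close> by (rule compact_imp_closed)
    fix c :: real and x assume "0 + c *\<^sub>R x \<in> N" "0 \<le> c" "0 + x \<in> N"
    then obtain u v where u: "norm u = 1" "x = radial K u *\<^sub>R u" and v: "norm v = 1" "c *\<^sub>R x = radial K v *\<^sub>R v"
      by (auto simp: N_def)
    from v u radial_pos[OF K] have "(c * radial K u) *\<^sub>R u = radial K v *\<^sub>R v" by simp
    moreover from this have "norm ((c * radial K u) *\<^sub>R u) = norm (radial K v *\<^sub>R v)" by simp
    then have "c * radial K u = radial K v"
      using u v radial_pos[OF K] \<open>0 \<le> c\<close> by (simp add: less_imp_le abs_mult)
    ultimately have "u = v" using radial_pos[OF K] v by (metis less_irrefl scaleR_left_imp_eq)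
    with \<open>c * radial K u = radial K v\<close> show "c = 1" using radial_pos[OF K u(1)] by simp
  qed
  then have "N \<in> null_sets lborel"
    using \<open>compact N\<close> by (simp add: negligible_iff_null_sets null_sets_completion_iff borel_compact)
  then have ae: "AE x in lborel. x \<notin> N" by (rule AE_not_in)
  have "emeasure lborel K = emeasure lborel {x. x \<noteq> 0 \<and> ennreal (norm x) < f (x /\<^sub>R norm x)}"
  proof (rule emeasure_eq_AE)
    show "AE x in lborel. x \<in> K \<longleftrightarrow> x \<in> {x. x \<noteq> 0 \<and> ennreal (norm x) < f (x /\<^sub>R norm x)}"
      using ae AE_lborel_singleton[of 0]
    proof eventually_elim
      fix x :: "real^'n" assume x: "x \<notin> N" "x \<noteq> 0"
      have "norm x \<noteq> radial K (x /\<^sub>R norm x)"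
      proof
        assume eq: "norm x = radial K (x /\<^sub>R norm x)"
        have "x = radial K (x /\<^sub>R norm x) *\<^sub>R (x /\<^sub>R norm x)" using x unfolding eq[symmetric] by simp
        then have "x \<in> N" unfolding N_def by (rule image_eqI) (use x in simp)
        with x show False by simp
      qed
      then show "x \<in> K \<longleftrightarrow> x \<in> {x. x \<noteq> 0 \<and> ennreal (norm x) < f (x /\<^sub>R norm x)}"
        using x by (auto simp: mem_star_body_iff_norm[OF K] f_def ennreal_less_iff)
    qed
  qed measurable
  also have "\<dots> = (\<integral>\<^sup>+x. f (x /\<^sub>R norm x) ^ CARD('n) * indicator ?B x \<partial>lborel)"
    by (subst emeasure_radial) (auto simp: f_def)
  also have "\<dots> = (\<integral>\<^sup>+x. ennreal (radial K (x /\<^sub>R norm x) ^ CARD('n)) * indicator ?B x \<partial>lborel)"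
    by (intro nn_integral_cong)
      (auto simp: f_def indicator_def ennreal_power less_imp_le radial_pos[OF K])
  finally have eq: "emeasure lborel K = \<dots>" .
  show ?thesis unfolding eq
    by (intro nn_integral_sphere_measure measurable_compose[OF _ measurable_ennreal]
        borel_measurable_on_sphere continuous_intros continuous_on_radial K)
qed

lemma emeasure_star_body_vol:
  assumes "K \<in> star_bodies"
  shows "emeasure lborel K = ennreal (vol K)"
  using emeasure_compact_finite[OF compact_star_body[OF assms]]
  by (simp add: measure_lebesgue_eq_lborel compact_star_body[OF assms] emeasure_eq_ennreal_measure less_top)

lemma vol_star_body_pos:
  fixes K :: "(real^'n) set"
  assumes K: "K \<in> star_bodies"
  shows "vol K > 0"
proof -
  obtain e where e: "e > 0" "ball 0 e \<subseteq> K"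
    using K by (auto simp: star_bodies_def mem_interior)
  have "0 < measure lebesgue (ball (0::real^'n) e)" using e by (simp add: content_ball_pos)
  also have "\<dots> \<le> vol K"
    using e compact_star_body[OF K] by (intro measure_mono_fmeasurable) (auto intro: lmeasurable_compact)
  finally show ?thesis .
qed

section \<open>The dual conical measure\<close>

lemma space_dual_vol_measure: "space (dual_vol_measure K) = sphere 0 1"
  by (simp add: dual_vol_measure_def space_sphere_measure)

lemma borel_measurable_dual_vol_measure:
  assumes "continuous_on (sphere 0 1) f"
  shows "f \<in> borel_measurable (dual_vol_measure K)"
  using borel_measurable_on_sphere[OF assms] by (simp add: dual_vol_measure_def)

lemma nn_integral_dual_vol_measure:
  fixes f :: "real^'n \<Rightarrow> real"
  assumes K: "K \<in> star_bodies" and f: "continuous_on (sphere 0 1) f"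
  shows "(\<integral>\<^sup>+u. ennreal (f u) \<partial>dual_vol_measure K) =
    (\<integral>\<^sup>+u. ennreal (radial K u ^ CARD('n) / (real CARD('n) * vol K)) * ennreal (f u) \<partial>sphere_measure)"
  unfolding dual_vol_measure_def using vol_star_body_pos[OF K]
  by (intro nn_integral_density measurable_compose[OF _ measurable_ennreal] borel_measurable_on_sphere
      continuous_intros continuous_on_radial K f) auto

text \<open>The density of the dual conical measure cancels the denominator and leaves the polar
  volume formula for \<open>L\<close>. The case \<open>L = K\<close> shows that the measure has
  total mass 1.\<close>

lemma nn_integral_radial_ratio:
  fixes K L :: "(real^'n) set"
  assumes K: "K \<in> star_bodies" and L: "L \<in> star_bodies"
  shows "(\<integral>\<^sup>+u. ennreal ((radial L u / radial K u) ^ CARD('n)) \<partial>dual_vol_measure K) = ennreal (vol L / vol K)"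
proof -
  note pos = radial_pos[OF K] radial_pos[OF L] vol_star_body_pos[OF K] vol_star_body_pos[OF L]
  have cont: "continuous_on (sphere 0 1) (\<lambda>u. (radial L u / radial K u) ^ CARD('n))"
    by (intro continuous_intros continuous_on_radial K L) (use pos(1) in force)
  have "(\<integral>\<^sup>+u. ennreal ((radial L u / radial K u) ^ CARD('n)) \<partial>dual_vol_measure K) =
    (\<integral>\<^sup>+u. ennreal (1 / (real CARD('n) * vol K)) * ennreal (radial L u ^ CARD('n)) \<partial>sphere_measure)"
    unfolding nn_integral_dual_vol_measure[OF K cont]
  proof (rule nn_integral_cong)
    fix u :: "real^'n" assume "u \<in> space sphere_measure"
    then have u: "norm u = 1" by (simp add: space_sphere_measure)
    have "radial K u ^ CARD('n) / (real CARD('n) * vol K) * (radial L u / radial K u) ^ CARD('n) =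
        1 / (real CARD('n) * vol K) * radial L u ^ CARD('n)"
      using pos(1)[OF u] by (simp add: power_divide)
    then show "ennreal (radial K u ^ CARD('n) / (real CARD('n) * vol K)) * ennreal ((radial L u / radial K u) ^ CARD('n)) =
        ennreal (1 / (real CARD('n) * vol K)) * ennreal (radial L u ^ CARD('n))"
      using pos(1,2)[OF u] pos(3,4) by (subst (1 2) ennreal_mult[symmetric]) auto
  qed
  also have "\<dots> = ennreal (1 / (real CARD('n) * vol K)) * (of_nat CARD('n) * ennreal (vol L))"
    unfolding emeasure_star_body_vol[OF L, symmetric] nn_integral_radial_power[OF L, symmetric]
    by (intro nn_integral_cmult measurable_compose[OF _ measurable_ennreal] borel_measurable_on_sphere
      continuous_intros continuous_on_radial L)
  also have "\<dots> = ennreal (1 / (real CARD('n) * vol K)) * (ennreal (real CARD('n)) * ennreal (vol L))"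
    by (simp add: ennreal_of_nat_eq_real_of_nat)
  also have "\<dots> = ennreal (vol L / vol K)"
    using pos(3,4) by (subst ennreal_mult[symmetric], simp, simp, subst ennreal_mult[symmetric]) auto
  finally show ?thesis .
qed

lemma emeasure_dual_vol_measure_space:
  fixes K :: "(real^'n) set"
  assumes K: "K \<in> star_bodies"
  shows "emeasure (dual_vol_measure K) (sphere 0 1) = 1"
proof -
  have "emeasure (dual_vol_measure K) (sphere 0 1) = (\<integral>\<^sup>+u. 1 \<partial>dual_vol_measure K)"
    by (simp add: space_dual_vol_measure)
  also have "\<dots> = (\<integral>\<^sup>+u. ennreal ((radial K u / radial K u) ^ CARD('n)) \<partial>dual_vol_measure K)"
  proof (rule nn_integral_cong)
    fix u assume "u \<in> space (dual_vol_measure K)"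
    then show "1 = ennreal ((radial K u / radial K u) ^ CARD('n))"
      using radial_pos[OF K, of u] by (simp add: space_dual_vol_measure)
  qed
  finally show ?thesis
    using vol_star_body_pos[OF K] unfolding nn_integral_radial_ratio[OF K K] by simp
qed

lemma finite_measure_dual_vol_measure: "K \<in> star_bodies \<Longrightarrow> finite_measure (dual_vol_measure K)"
  by (rule finite_measureI) (simp add: space_dual_vol_measure emeasure_dual_vol_measure_space)

lemma integral_dual_vol_measure_const:
  fixes c :: real
  assumes K: "K \<in> star_bodies"
  shows "(\<integral>u. c \<partial>dual_vol_measure K) = c"
  using emeasure_dual_vol_measure_space[OF K] by (simp add: space_dual_vol_measure measure_def)

lemma integrable_dual_vol_measure:
  fixes f :: "real^'n \<Rightarrow> real"
  assumes K: "K \<in> star_bodies" and f: "continuous_on (sphere 0 1) f"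
  shows "integrable (dual_vol_measure K) f"
proof -
  have "compact (f ` sphere 0 1)" by (intro compact_continuous_image f compact_sphere)
  then obtain B where "\<And>u. norm u = 1 \<Longrightarrow> norm (f u) \<le> B"
    using compact_imp_bounded bounded_iff by (metis dist_0_norm image_eqI mem_sphere)
  then show ?thesis
    by (intro finite_measure.integrable_const_bound[OF finite_measure_dual_vol_measure[OF K], of _ B]
        borel_measurable_dual_vol_measure f) (auto simp: space_dual_vol_measure)
qed

text \<open>The measure has full support: if \<open>f u\<close> were nonzero, the cone over the
  directions where \<open>f\<close> does not vanish would be a nonempty open set, yet Lebesgue null.
  All equality cases below rest on this.\<close>

lemma integral_dual_vol_measure_eq_0:
  fixes f :: "real^'n \<Rightarrow> real"
  assumes K: "K \<in> star_bodies" and f: "continuous_on (sphere 0 1) f"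
    and nonneg: "\<And>u. norm u = 1 \<Longrightarrow> 0 \<le> f u"
    and int: "(\<integral>u. f u \<partial>dual_vol_measure K) \<le> 0" and u: "norm u = 1"
  shows "f u = 0"
proof (rule ccontr)
  assume "f u \<noteq> 0"
  let ?w = "\<lambda>u. radial K u ^ CARD('n) / (real CARD('n) * vol K)"
  let ?B = "cball 0 1 - {0} :: (real ^ 'n) set"
  have w: "?w u > 0" if "norm u = 1" for u
    using radial_pos[OF K that] vol_star_body_pos[OF K] by simp
  have cw: "continuous_on (sphere 0 1) (\<lambda>u. ?w u * f u)"
    using vol_star_body_pos[OF K] by (intro continuous_intros continuous_on_radial K f) auto
  have mw: "(\<lambda>u. ennreal (?w u * f u)) \<in> borel_measurable sphere_measure"
    by (intro measurable_compose[OF _ measurable_ennreal] borel_measurable_on_sphere cw)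
  have "(\<integral>\<^sup>+u. ennreal (f u) \<partial>dual_vol_measure K) = ennreal (\<integral>u. f u \<partial>dual_vol_measure K)"
    by (intro nn_integral_eq_integral integrable_dual_vol_measure K f AE_I2)
      (simp add: nonneg space_dual_vol_measure)
  then have "(\<integral>\<^sup>+u. ennreal (f u) \<partial>dual_vol_measure K) = 0"
    using int by (simp add: ennreal_neg)
  moreover have "(\<integral>\<^sup>+u. ennreal (?w u) * ennreal (f u) \<partial>sphere_measure) =
      (\<integral>\<^sup>+u. ennreal (?w u * f u) \<partial>sphere_measure)"
    by (intro nn_integral_cong ennreal_mult[symmetric])
      (auto simp: space_sphere_measure nonneg w[THEN less_imp_le])
  ultimately have "(\<integral>\<^sup>+u. ennreal (?w u * f u) \<partial>sphere_measure) = 0"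
    by (simp add: nn_integral_dual_vol_measure[OF K f])
  then have 0: "(\<integral>\<^sup>+x. ennreal (?w (x /\<^sub>R norm x) * f (x /\<^sub>R norm x)) * indicator ?B x \<partial>lborel) = 0"
    by (subst (asm) nn_integral_sphere_measure[OF mw]) simp
  define W where "W = {x \<in> ball 0 1 - {0}. f (x /\<^sub>R norm x) \<noteq> 0}"
  have sphere: "(\<lambda>x. x /\<^sub>R norm x) ` (S - {0}) \<subseteq> sphere 0 1" for S :: "(real^'n) set"
    using normalize_mem_sphere by blast
  have cg: "continuous_on (ball 0 1 - {0}) (\<lambda>x. f (x /\<^sub>R norm x))"
    by (rule continuous_on_compose2[OF f _ sphere]) (auto intro!: continuous_intros)
  have "open W"
  proof -
    have "W = (ball 0 1 - {0}) \<inter> (\<lambda>x. f (x /\<^sub>R norm x)) -` (- {0})" by (auto simp: W_def)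
    also have "open \<dots>" by (rule continuous_open_preimage[OF cg]) auto
    finally show ?thesis .
  qed
  \<comment> \<open>Extension by 0 again yields a Borel function on the whole space, so that a
    vanishing integral gives \<open>g = 0\<close> almost everywhere.\<close>
  define g where "g x = indicator ?B x *\<^sub>R (?w (x /\<^sub>R norm x) * f (x /\<^sub>R norm x))" for x
  have "continuous_on ?B (\<lambda>x. ?w (x /\<^sub>R norm x) * f (x /\<^sub>R norm x))"
    by (rule continuous_on_compose2[OF cw _ sphere]) (auto intro!: continuous_intros)
  then have [measurable]: "g \<in> borel_measurable borel"
    unfolding g_def by (intro borel_measurable_continuous_on_indicator) auto
  have "(\<integral>\<^sup>+x. ennreal (g x) \<partial>lborel) =
      (\<integral>\<^sup>+x. ennreal (?w (x /\<^sub>R norm x) * f (x /\<^sub>R norm x)) * indicator ?B x \<partial>lborel)"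
    by (rule nn_integral_cong) (auto simp: g_def indicator_def)
  from trans[OF this 0] have "(\<integral>\<^sup>+x. ennreal (g x) \<partial>lborel) = 0" .
  then have "AE x in lborel. ennreal (g x) = 0"
    by (subst (asm) nn_integral_0_iff_AE) auto
  then have "AE x in lborel. x \<notin> W"
  proof eventually_elim
    case (elim x)
    show "x \<notin> W"
    proof
      assume "x \<in> W"
      then have x: "x \<noteq> 0" "norm x < 1" "f (x /\<^sub>R norm x) \<noteq> 0" by (auto simp: W_def)
      have n: "norm (x /\<^sub>R norm x) = 1" using x by simp
      have "f (x /\<^sub>R norm x) > 0" using nonneg[OF n] x(3) by simp
      from mult_pos_pos[OF w[OF n] this] have "g x > 0" using x by (simp add: g_def)
      with elim show False by simp
    qed
  qed
  then have "W \<in> null_sets lborel"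
    using \<open>open W\<close> by (subst AE_iff_null_sets) auto
  then have "negligible W"
    by (simp add: negligible_iff_null_sets null_sets_completionI)
  moreover have "(1/2) *\<^sub>R u \<in> W" using u \<open>f u \<noteq> 0\<close> by (auto simp: W_def)
  ultimately show False using \<open>open W\<close> open_not_negligible by blast
qed

section \<open>Orlicz functions and ellipsoids\<close>

lemma Phi_nonneg: "\<phi> \<in> Phi \<Longrightarrow> 0 \<le> t \<Longrightarrow> 0 \<le> \<phi> t"
  and Phi_less: "\<phi> \<in> Phi \<Longrightarrow> 0 \<le> s \<Longrightarrow> s < t \<Longrightarrow> \<phi> s < \<phi> t"
  and Phi_zero: "\<phi> \<in> Phi \<Longrightarrow> \<phi> 0 = 0"
  and Phi_convex: "\<phi> \<in> Phi \<Longrightarrow> convex_on {0..} \<phi>"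
  by (auto simp: Phi_def image_subset_iff strict_mono_on_def)

lemma Phi_le: "\<phi> \<in> Phi \<Longrightarrow> 0 \<le> s \<Longrightarrow> s \<le> t \<Longrightarrow> \<phi> s \<le> \<phi> t"
  using Phi_less[of \<phi> s t] by (cases "s = t") auto

lemma id_in_Phi: "(\<lambda>x. x) \<in> Phi"
  by (auto simp: Phi_def convex_on_def strict_mono_on_def)

lemma Phi_le_scale: "\<phi> \<in> Phi \<Longrightarrow> 0 \<le> t \<Longrightarrow> t \<le> 1 \<Longrightarrow> 0 \<le> x \<Longrightarrow> \<phi> (t * x) \<le> t * \<phi> x"
  using convex_onD[OF Phi_convex, of \<phi> t 0 x] by (simp add: Phi_zero)

text \<open>Convexity gives continuity at interior points only; at the endpoint 0 the function is
  squeezed between 0 and \<open>t * \<phi> 1\<close>.\<close>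

lemma Phi_continuous_on:
  assumes \<phi>: "\<phi> \<in> Phi"
  shows "continuous_on {0..} \<phi>"
  unfolding continuous_on_eq_continuous_within
proof
  fix x :: real assume "x \<in> {0..}"
  then consider "x > 0" | "x = 0" by force
  then show "continuous (at x within {0..}) \<phi>"
  proof cases
    case 1
    have "continuous_on {0<..} \<phi>"
      by (rule convex_on_continuous[OF _ convex_on_subset[OF Phi_convex[OF \<phi>]]]) auto
    then have "isCont \<phi> x" using 1 by (simp add: continuous_on_eq_continuous_at)
    then show ?thesis by (rule continuous_at_imp_continuous_at_within)
  next
    case 2
    have ev: "eventually (\<lambda>t. 0 \<le> t \<and> t \<le> 1) (at (0::real) within {0..})"
      unfolding eventually_at by (intro exI[of _ 1]) (auto simp: dist_real_def)
    have "(\<phi> \<longlongrightarrow> 0) (at 0 within {0..})"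
    proof (rule tendsto_sandwich)
      show "\<forall>\<^sub>F t in at 0 within {0..}. 0 \<le> \<phi> t"
        using ev by eventually_elim (simp add: Phi_nonneg[OF \<phi>])
      show "\<forall>\<^sub>F t in at 0 within {0..}. \<phi> t \<le> t * \<phi> 1"
        using ev by eventually_elim (use Phi_le_scale[OF \<phi>, of _ 1] in auto)
      show "((\<lambda>t. t * \<phi> 1) \<longlongrightarrow> 0) (at 0 within {0..})"
        by (auto intro!: tendsto_eq_intros)
    qed simp
    then show ?thesis using 2 by (simp add: continuous_within Phi_zero[OF \<phi>])
  qed
qed

text \<open>Convexity with \<open>\<phi> 0 = 0\<close> gives
  \<open>b * \<phi> 1 \<le> \<phi> b\<close> for \<open>b \<ge> 1\<close>, so \<open>\<phi>\<close>
  is unbounded and the intermediate value theorem applies. This makes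
  \<open>inv_into {0..} \<phi>\<close> a genuine inverse on the nonnegative reals.\<close>

lemma Phi_surj:
  assumes \<phi>: "\<phi> \<in> Phi" and y: "0 \<le> y"
  shows "y \<in> \<phi> ` {0..}"
proof -
  have pos: "\<phi> 1 > 0" using Phi_less[OF \<phi>, of 0 1] by (simp add: Phi_zero[OF \<phi>])
  define b where "b = max 1 (y / \<phi> 1)"
  have b: "b \<ge> 1" "y \<le> b * \<phi> 1" using pos by (auto simp: b_def field_simps max_def)
  have "\<phi> 1 \<le> \<phi> b / b" using Phi_le_scale[OF \<phi>, of "1 / b" b] b by simp
  then have "y \<le> \<phi> b" using b by (simp add: field_simps)
  moreover have "continuous_on {0..b} \<phi>"
    using Phi_continuous_on[OF \<phi>] by (rule continuous_on_subset) auto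
  ultimately obtain x where "0 \<le> x" "\<phi> x = y"
    using IVT'[of \<phi> 0 y b] y b by (auto simp: Phi_zero[OF \<phi>])
  then show ?thesis by auto
qed

lemma Phi_inv_le_1_iff:
  assumes \<phi>: "\<phi> \<in> Phi" and y: "0 \<le> y"
  shows "inv_into {0..} \<phi> y \<le> 1 \<longleftrightarrow> y \<le> \<phi> 1"
proof -
  have "0 \<le> inv_into {0..} \<phi> y" and eq: "\<phi> (inv_into {0..} \<phi> y) = y"
    using inv_into_into[OF Phi_surj[OF \<phi> y]] f_inv_into_f[OF Phi_surj[OF \<phi> y]] by auto
  then show ?thesis
    using Phi_le[OF \<phi>, of "inv_into {0..} \<phi> y" 1] Phi_less[OF \<phi>, of 1 "inv_into {0..} \<phi> y"]
    by force
qed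

text \<open>The slope is positive because at \<open>t = 0\<close> the supporting line lies below
  \<open>\<phi> 0 = 0\<close>, which forces \<open>c \<ge> \<phi> 1 > 0\<close>.\<close>

lemma Phi_supporting_line:
  assumes \<phi>: "\<phi> \<in> Phi"
  obtains c where "c > 0" "\<And>t. 0 \<le> t \<Longrightarrow> \<phi> 1 + c * (t - 1) \<le> \<phi> t"
proof -
  obtain c where c: "\<And>t. 0 \<le> t \<Longrightarrow> \<phi> 1 + c * (t - 1) \<le> \<phi> t"
    using convex_le_Inf_differential[OF Phi_convex[OF \<phi>], of 1] by auto
  have "c > 0" using c[of 0] Phi_less[OF \<phi>, of 0 1] by (simp add: Phi_zero[OF \<phi>])
  with c that show thesis by blast
qed

text \<open>For invertible \<open>A\<close> this is the image of the unit ball under the inverse of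
  \<open>A\<close>. Parametrizing by the inverse makes the reciprocal radial function
  \<open>norm (A *v u)\<close>, which is convex in \<open>A\<close>.\<close>

definition gauge_ellipsoid :: "real^'n^'n \<Rightarrow> (real^'n) set" where
  "gauge_ellipsoid A = {x. norm (A *v x) \<le> 1}"

lemma norm_matrix_vector_pos:
  fixes A :: "real^'n^'n"
  assumes "invertible A" "u \<noteq> 0"
  shows "0 < norm (A *v u)"
  using assms by (metis invertible_def matrix_left_invertible_ker zero_less_norm_iff)

lemma continuous_on_norm_matrix_vector:
  fixes A :: "real^'n^'n"
  shows "continuous_on S (\<lambda>u. norm (A *v u))"
  by (intro continuous_on_norm matrix_vector_mult_linear_continuous_on)

lemma gauge_ellipsoid_eq_image:
  fixes A B :: "real^'n^'n"
  assumes "A ** B = mat 1"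
  shows "gauge_ellipsoid A = (*v) B ` cball 0 1"
proof -
  have BA: "B ** A = mat 1" using assms matrix_left_right_inverse by blast
  show ?thesis
  proof (intro set_eqI iffI)
    fix x assume "x \<in> gauge_ellipsoid A"
    then show "x \<in> (*v) B ` cball 0 1"
      by (intro image_eqI[of _ _ "A *v x"]) (auto simp: gauge_ellipsoid_def matrix_vector_mul_assoc BA)
  next
    fix x assume "x \<in> (*v) B ` cball 0 1"
    then show "x \<in> gauge_ellipsoid A"
      by (auto simp: gauge_ellipsoid_def matrix_vector_mul_assoc assms)
  qed
qed

lemma ellipsoids_iff_gauge:
  fixes E :: "(real^'n) set"
  shows "E \<in> ellipsoids \<longleftrightarrow> (\<exists>A. invertible A \<and> E = gauge_ellipsoid A)"
proof
  assume "E \<in> ellipsoids"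
  then obtain f :: "real^'n \<Rightarrow> real^'n" where f: "linear f" "bij f" "E = f ` cball 0 1"
    by (auto simp: ellipsoids_def)
  obtain g where g: "linear g" "g \<circ> f = id" "f \<circ> g = id"
    using linear_injective_isomorphism[OF f(1) bij_is_inj[OF f(2)]] by (auto simp: fun_eq_iff)
  have 1: "matrix g ** matrix f = mat 1" "matrix f ** matrix g = mat 1"
    using matrix_compose[OF f(1) g(1)] matrix_compose[OF g(1) f(1)] g by (simp_all add: matrix_id_mat_1)
  then have "gauge_ellipsoid (matrix g) = (*v) (matrix f) ` cball 0 1"
    by (intro gauge_ellipsoid_eq_image)
  also have "\<dots> = E" using f by (simp add: matrix_works fun_eq_iff image_def)
  finally show "\<exists>A. invertible A \<and> E = gauge_ellipsoid A" using 1 unfolding invertible_def by blast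
next
  assume "\<exists>A. invertible A \<and> E = gauge_ellipsoid A"
  then obtain A B :: "real^'n^'n" where AB: "A ** B = mat 1" "B ** A = mat 1" "E = gauge_ellipsoid A"
    by (auto simp: invertible_def)
  have "bij ((*v) B)"
    by (rule o_bij[of "(*v) A"]) (auto simp: fun_eq_iff matrix_vector_mul_assoc AB)
  then show "E \<in> ellipsoids"
    using gauge_ellipsoid_eq_image[OF AB(1)] AB(3) matrix_vector_mul_linear[of B]
    by (auto simp: ellipsoids_def)
qed

lemma radial_gauge_ellipsoid:
  fixes A :: "real^'n^'n"
  assumes "invertible A" "u \<noteq> 0"
  shows "radial (gauge_ellipsoid A) u = 1 / norm (A *v u)"
proof -
  have "{t. 0 \<le> t \<and> t *\<^sub>R u \<in> gauge_ellipsoid A} = {0..1 / norm (A *v u)}"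
    using norm_matrix_vector_pos[OF assms]
    by (auto simp: gauge_ellipsoid_def matrix_vector_mult_scaleR field_simps)
  then show ?thesis by (simp add: radial_def)
qed

lemma gauge_ellipsoid_in_star_bodies:
  fixes A :: "real^'n^'n"
  assumes A: "invertible A"
  shows "gauge_ellipsoid A \<in> star_bodies"
  unfolding star_bodies_def
proof (intro CollectI conjI ballI)
  obtain B where B: "A ** B = mat 1" using A by (auto simp: invertible_def)
  show "compact (gauge_ellipsoid A)"
    unfolding gauge_ellipsoid_eq_image[OF B]
    by (intro compact_continuous_image matrix_vector_mult_linear_continuous_on compact_cball)
  show "t *\<^sub>R x \<in> gauge_ellipsoid A" if "x \<in> gauge_ellipsoid A" "t \<in> {0..1}" for x and t :: real
    using that mult_mono[of t 1 "norm (A *v x)" 1] by (auto simp: gauge_ellipsoid_def matrix_vector_mult_scaleR)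
  show "0 \<in> interior (gauge_ellipsoid A)"
  proof (rule interiorI)
    show "open {x. norm (A *v x) < 1}"
      by (intro open_Collect_less continuous_on_norm_matrix_vector continuous_intros)
  qed (auto simp: gauge_ellipsoid_def)
  have "norm (A *v u) \<noteq> 0" if "u \<in> sphere 0 1" for u
  proof -
    have "u \<noteq> 0" using that by auto
    from norm_matrix_vector_pos[OF A this] show ?thesis by simp
  qed
  then have "continuous_on (sphere 0 1) (\<lambda>u. 1 / norm (A *v u))"
    by (intro continuous_intros continuous_on_norm_matrix_vector) auto
  moreover have "\<And>u. u \<in> sphere 0 1 \<Longrightarrow> radial (gauge_ellipsoid A) u = 1 / norm (A *v u)"
    by (intro radial_gauge_ellipsoid A) auto
  ultimately show "continuous_on (sphere 0 1) (radial (gauge_ellipsoid A))"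
    by (auto intro: continuous_on_eq)
qed

lemma vol_gauge_ellipsoid:
  fixes A :: "real^'n^'n"
  assumes "invertible A"
  shows "vol (gauge_ellipsoid A) = vol (cball (0::real^'n) 1) / \<bar>det A\<bar>"
proof -
  obtain B where B: "A ** B = mat 1" "B ** A = mat 1" using assms by (auto simp: invertible_def)
  have "det A * det B = 1" using arg_cong[OF B(1), of det] by (simp add: det_mul)
  then have "\<bar>det B\<bar> = 1 / \<bar>det A\<bar>" by (metis abs_1 abs_mult mult_cancel_left1 nonzero_eq_divide_eq mult.commute zero_neq_one abs_zero mult_zero_left)
  moreover have "invertible B" using B by (auto simp: invertible_def)
  ultimately show ?thesis
    unfolding gauge_ellipsoid_eq_image[OF B(1)] by (simp add: measure_invertible_image_cball)
qed

lemma det_scaleR: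
  fixes A :: "real^'n^'n"
  shows "det (c *\<^sub>R A) = c ^ CARD('n) * det A"
proof -
  have "c *\<^sub>R A = (\<chi> i. c *s A $ i)" by (simp add: vec_eq_iff)
  then show ?thesis by (simp add: det_rows_mul)
qed

lemma continuous_on_det: "continuous_on S (det :: real^'n^'n \<Rightarrow> real)"
  unfolding det_def by (intro continuous_intros)

text \<open>The eigenvalue of the sum of two basis vectors must agree with the eigenvalue of each,
  as coordinates \<open>i\<close> and \<open>j\<close> show; hence all basis vectors share one
  eigenvalue.\<close>

lemma matrix_all_eigenvectors_imp_scalar:
  fixes M :: "real^'n^'n"
  assumes "\<And>v. \<exists>c. M *v v = c *\<^sub>R v"
  shows "\<exists>c. M = c *\<^sub>R mat 1"
proof -
  obtain c where c: "\<And>v. M *v v = c v *\<^sub>R v" using assms by metis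
  have eq: "c (axis i 1) = c (axis j 1)" for i j
  proof (cases "i = j")
    case False
    define s where "s = c (axis i 1 + axis j 1)"
    have "s *\<^sub>R (axis i 1 + axis j 1) = c (axis i 1) *\<^sub>R axis i 1 + c (axis j 1) *\<^sub>R (axis j 1 :: real^'n)"
      unfolding s_def c[symmetric] by (rule matrix_vector_right_distrib)
    then have *: "(s *\<^sub>R (axis i 1 + axis j 1)) $ k = (c (axis i 1) *\<^sub>R axis i 1 + c (axis j 1) *\<^sub>R (axis j 1 :: real^'n)) $ k" for k
      by simp
    show ?thesis using *[of i] *[of j] False by (simp add: axis_def)
  qed simp
  \<comment> \<open>Here \<open>undefined\<close> merely names some fixed index of type
    \<open>'n\<close>.\<close>
  have "M $ i $ j = (c (axis undefined 1) *\<^sub>R mat 1) $ i $ j" for i j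
  proof -
    have "M $ i $ j = (M *v axis j 1) $ i" by (simp add: matrix_vector_mult_basis column_def)
    also have "\<dots> = c (axis undefined 1) * axis j 1 $ i" unfolding c using eq[of j undefined] by simp
    finally show ?thesis by (simp add: mat_def axis_def)
  qed
  then show ?thesis by (metis vec_eq_iff)
qed

section \<open>The extremal problem\<close>

text \<open>For invertible \<open>A\<close> this is the integral in \<open>Orlicz_functional\<close>
  with \<open>L = gauge_ellipsoid A\<close> and \<open>t = 1\<close>. It is defined for singular
  matrices too, so that convexity and compactness can be used in the whole matrix space.\<close>

definition Orlicz_integral :: "(real \<Rightarrow> real) \<Rightarrow> (real^'n) set \<Rightarrow> real^'n^'n \<Rightarrow> real" where
  "Orlicz_integral \<phi> K A = (\<integral>u. \<phi> (radial K u * norm (A *v u)) \<partial>dual_vol_measure K)"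

locale Orlicz_Legendre_problem =
  fixes K :: "(real^'n) set" and \<phi> :: "real \<Rightarrow> real"
  assumes K: "K \<in> star_bodies" and \<phi>: "\<phi> \<in> Phi"
begin

section \<open>Monotonicity, convexity and continuity of the Orlicz integral in the matrix\<close>

lemma radial_norm_nonneg: "norm u = 1 \<Longrightarrow> 0 \<le> radial K u * norm (A *v u)"
  for A :: "real^'n^'n"
  using radial_pos[OF K, of u] by simp

lemma continuous_on_Orlicz_integrand:
  fixes A :: "real^'n^'n"
  shows "continuous_on (sphere 0 1) (\<lambda>u. \<phi> (radial K u * norm (A *v u)))"
  by (rule continuous_on_compose2[OF Phi_continuous_on[OF \<phi>]])
    (auto intro!: continuous_intros continuous_on_radial K continuous_on_norm_matrix_vector
      simp: radial_norm_nonneg)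

lemma integrable_Orlicz_integrand:
  fixes A :: "real^'n^'n"
  shows "integrable (dual_vol_measure K) (\<lambda>u. \<phi> (radial K u * norm (A *v u)))"
  by (intro integrable_dual_vol_measure K continuous_on_Orlicz_integrand)

lemma Orlicz_integral_nonneg: "0 \<le> Orlicz_integral \<phi> K A"
  unfolding Orlicz_integral_def
  by (intro Bochner_Integration.integral_nonneg_AE AE_I2)
    (auto simp: space_dual_vol_measure Phi_nonneg[OF \<phi>] radial_norm_nonneg)

lemma Orlicz_integral_mono:
  fixes A B :: "real^'n^'n"
  assumes "\<And>u. norm u = 1 \<Longrightarrow> norm (A *v u) \<le> norm (B *v u)"
  shows "Orlicz_integral \<phi> K A \<le> Orlicz_integral \<phi> K B"
  unfolding Orlicz_integral_def
proof (intro integral_mono integrable_Orlicz_integrand)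
  fix u assume "u \<in> space (dual_vol_measure K)"
  then have u: "norm u = 1" by (simp add: space_dual_vol_measure)
  show "\<phi> (radial K u * norm (A *v u)) \<le> \<phi> (radial K u * norm (B *v u))"
    using assms[OF u] radial_pos[OF K u]
    by (intro Phi_le[OF \<phi>] radial_norm_nonneg u mult_left_mono) simp_all
qed

lemma Orlicz_integral_le_1I:
  fixes A :: "real^'n^'n"
  assumes "\<And>u. norm u = 1 \<Longrightarrow> radial K u * norm (A *v u) \<le> 1"
  shows "Orlicz_integral \<phi> K A \<le> \<phi> 1"
proof -
  have "Orlicz_integral \<phi> K A \<le> (\<integral>u. \<phi> 1 \<partial>dual_vol_measure K)"
    unfolding Orlicz_integral_def
  proof (intro integral_mono integrable_Orlicz_integrand)
    show "integrable (dual_vol_measure K) (\<lambda>u. \<phi> 1)"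
      by (intro integrable_dual_vol_measure K continuous_intros)
    fix u assume "u \<in> space (dual_vol_measure K)"
    then show "\<phi> (radial K u * norm (A *v u)) \<le> \<phi> 1"
      by (intro Phi_le[OF \<phi>] radial_norm_nonneg assms) (simp_all add: space_dual_vol_measure)
  qed
  then show ?thesis by (simp only: integral_dual_vol_measure_const[OF K])
qed

text \<open>The first bound is the triangle inequality under the increasing \<open>\<phi>\<close>,
  the second is convexity of \<open>\<phi>\<close>. They are kept apart because uniqueness needs
  strictness in the first alone: \<open>\<phi>\<close> need not be strictly convex.\<close>

lemma Orlicz_integrand_convex:
  fixes A B :: "real^'n^'n"
  assumes t: "0 \<le> t" "t \<le> 1" and u: "norm u = 1"
  shows "\<phi> (radial K u * norm (((1 - t) *\<^sub>R A + t *\<^sub>R B) *v u)) \<le>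
    \<phi> ((1 - t) * (radial K u * norm (A *v u)) + t * (radial K u * norm (B *v u)))"
    and "\<phi> ((1 - t) * (radial K u * norm (A *v u)) + t * (radial K u * norm (B *v u))) \<le>
    (1 - t) * \<phi> (radial K u * norm (A *v u)) + t * \<phi> (radial K u * norm (B *v u))"
proof -
  have "norm (((1 - t) *\<^sub>R A + t *\<^sub>R B) *v u) \<le> (1 - t) * norm (A *v u) + t * norm (B *v u)"
    using t norm_triangle_ineq[of "(1 - t) *\<^sub>R (A *v u)" "t *\<^sub>R (B *v u)"]
    by (simp add: matrix_vector_mult_add_rdistrib flip: scaleR_matrix_vector_assoc)
  then have "radial K u * norm (((1 - t) *\<^sub>R A + t *\<^sub>R B) *v u) \<le>
      radial K u * ((1 - t) * norm (A *v u) + t * norm (B *v u))"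
    using radial_pos[OF K u] by simp
  then show "\<phi> (radial K u * norm (((1 - t) *\<^sub>R A + t *\<^sub>R B) *v u)) \<le>
    \<phi> ((1 - t) * (radial K u * norm (A *v u)) + t * (radial K u * norm (B *v u)))"
    by (intro Phi_le[OF \<phi>] radial_norm_nonneg u) (simp add: algebra_simps)
  show "\<phi> ((1 - t) * (radial K u * norm (A *v u)) + t * (radial K u * norm (B *v u))) \<le>
    (1 - t) * \<phi> (radial K u * norm (A *v u)) + t * \<phi> (radial K u * norm (B *v u))"
    using convex_onD[OF Phi_convex[OF \<phi>] t, of "radial K u * norm (A *v u)" "radial K u * norm (B *v u)"]
      radial_norm_nonneg[OF u] by simp
qed

lemma convex_on_Orlicz_integral: "convex_on UNIV (Orlicz_integral \<phi> K)"
proof (rule convex_onI)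
  fix t :: real and A B :: "real^'n^'n" assume t: "0 < t" "t < 1"
  let ?f = "\<lambda>A u. \<phi> (radial K u * norm (A *v u))"
  have "Orlicz_integral \<phi> K ((1 - t) *\<^sub>R A + t *\<^sub>R B) \<le>
      (\<integral>u. (1 - t) * ?f A u + t * ?f B u \<partial>dual_vol_measure K)"
    unfolding Orlicz_integral_def
  proof (intro integral_mono integrable_Orlicz_integrand)
    fix u assume "u \<in> space (dual_vol_measure K)"
    then have u: "norm u = 1" by (simp add: space_dual_vol_measure)
    show "?f ((1 - t) *\<^sub>R A + t *\<^sub>R B) u \<le> (1 - t) * ?f A u + t * ?f B u"
      using Orlicz_integrand_convex[of t u A B] t u by linarith
  qed (intro Bochner_Integration.integrable_add integrable_mult_right integrable_Orlicz_integrand)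
  also have "\<dots> = (1 - t) * Orlicz_integral \<phi> K A + t * Orlicz_integral \<phi> K B"
    using integrable_Orlicz_integrand by (simp add: Orlicz_integral_def)
  finally show "Orlicz_integral \<phi> K ((1 - t) *\<^sub>R A + t *\<^sub>R B) \<le>
    (1 - t) * Orlicz_integral \<phi> K A + t * Orlicz_integral \<phi> K B" .
qed simp

text \<open>A finite convex function on a finite-dimensional space is continuous.\<close>

lemma continuous_on_Orlicz_integral: "continuous_on S (Orlicz_integral \<phi> K)"
  using convex_on_continuous[OF open_UNIV convex_on_Orlicz_integral] continuous_on_subset by blast

lemma tendsto_Orlicz_integral_scaleR:
  "(r \<longlongrightarrow> 1) F \<Longrightarrow> ((\<lambda>x. Orlicz_integral \<phi> K (r x *\<^sub>R A)) \<longlongrightarrow> Orlicz_integral \<phi> K A) F"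
  by (rule continuous_on_tendsto_compose[OF continuous_on_Orlicz_integral[of UNIV]])
    (use tendsto_scaleR[of r 1 F "\<lambda>_. A" A] in auto)

section \<open>The constraint on ellipsoids as a constraint on matrices\<close>

lemma radial_bounded: "\<exists>M>0. \<forall>u. norm u = 1 \<longrightarrow> radial K u \<le> M"
proof -
  have "compact (radial K ` sphere 0 1)"
    by (intro compact_continuous_image continuous_on_radial K compact_sphere)
  then obtain B where "\<And>u. norm u = 1 \<Longrightarrow> norm (radial K u) \<le> B"
    using compact_imp_bounded bounded_iff by (metis dist_0_norm image_eqI mem_sphere)
  then show ?thesis by (intro exI[of _ "max 1 B"]) force
qed

text \<open>Dividing the argument by \<open>t\<close> amounts to scaling \<open>A\<close> by
  \<open>1 / t\<close>, so the infimum is over an upward closed set \<open>S\<close> of scales.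
  \<open>Inf S \<le> 1\<close> yields the bound only for scales \<open>s > 1\<close>; continuity
  carries it to \<open>s = 1\<close>.\<close>

lemma Orlicz_functional_gauge_le_1_iff:
  fixes A :: "real^'n^'n"
  assumes A: "invertible A"
  shows "Orlicz_functional \<phi> K (gauge_ellipsoid A) \<le> 1 \<longleftrightarrow> Orlicz_integral \<phi> K A \<le> \<phi> 1"
proof -
  define S where "S = {t. 0 < t \<and> Orlicz_integral \<phi> K ((1 / t) *\<^sub>R A) \<le> \<phi> 1}"
  have "(\<integral>u. \<phi> (radial K u / (t * radial (gauge_ellipsoid A) u)) \<partial>dual_vol_measure K) =
      Orlicz_integral \<phi> K ((1 / t) *\<^sub>R A)" if t: "0 < t" for t
    unfolding Orlicz_integral_def
  proof (rule Bochner_Integration.integral_cong[OF refl])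
    fix u assume "u \<in> space (dual_vol_measure K)"
    then have "norm u = 1" "u \<noteq> 0" by (auto simp: space_dual_vol_measure)
    then show "\<phi> (radial K u / (t * radial (gauge_ellipsoid A) u)) = \<phi> (radial K u * norm (((1 / t) *\<^sub>R A) *v u))"
      using t radial_gauge_ellipsoid[OF A, of u] by (simp flip: scaleR_matrix_vector_assoc)
  qed
  then have "{t. 0 < t \<and> inv_into {0..} \<phi> (\<integral>u. \<phi> (radial K u / (t * radial (gauge_ellipsoid A) u))
      \<partial>dual_vol_measure K) \<le> 1} = S"
    by (auto simp: S_def Phi_inv_le_1_iff[OF \<phi> Orlicz_integral_nonneg])
  then have Inf: "Orlicz_functional \<phi> K (gauge_ellipsoid A) = Inf S"
    by (simp add: Orlicz_functional_def)
  have bdd: "bdd_below S" by (rule bdd_belowI[of _ 0]) (auto simp: S_def)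
  have mono: "Orlicz_integral \<phi> K ((1 / s) *\<^sub>R A) \<le> \<phi> 1" if "t \<in> S" "t < s" for s t
  proof -
    have "Orlicz_integral \<phi> K ((1 / s) *\<^sub>R A) \<le> Orlicz_integral \<phi> K ((1 / t) *\<^sub>R A)"
      using that by (intro Orlicz_integral_mono)
        (auto simp: S_def frac_le mult_right_mono simp flip: scaleR_matrix_vector_assoc intro!: divide_left_mono)
    with that show ?thesis by (simp add: S_def)
  qed
  \<comment> \<open>Needed since the infimum of an empty set of reals carries no information. With
    \<open>M\<close> bounding the radial function and \<open>N\<close> the operator norm of
    \<open>A\<close>, the scale \<open>M * N\<close> brings the argument of \<open>\<phi>\<close>
    down to at most 1.\<close>
  have "S \<noteq> {}"
  proof -
    obtain M where M: "M > 0" "\<And>u. norm u = 1 \<Longrightarrow> radial K u \<le> M" using radial_bounded by blast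
    obtain N where N: "N > 0" "\<And>u. norm (A *v u) \<le> norm u * N"
      using bounded_linear.pos_bounded[of "(*v) A"] matrix_vector_mul_bounded_linear by blast
    have "Orlicz_integral \<phi> K ((1 / (M * N)) *\<^sub>R A) \<le> \<phi> 1"
    proof (rule Orlicz_integral_le_1I)
      fix u :: "real^'n" assume u: "norm u = 1"
      have "radial K u * norm (A *v u) \<le> M * N"
        using M(2)[OF u] N(2)[of u] u M(1) N(1) by (intro mult_mono) auto
      then show "radial K u * norm (((1 / (M * N)) *\<^sub>R A) *v u) \<le> 1"
        using M(1) N(1) by (simp add: field_simps flip: scaleR_matrix_vector_assoc)
    qed
    then show ?thesis using M(1) N(1) by (auto simp: S_def intro!: exI[of _ "M * N"])
  qed
  show ?thesis unfolding Inf
  proof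
    assume "Orlicz_integral \<phi> K A \<le> \<phi> 1"
    then show "Inf S \<le> 1" by (intro cInf_lower bdd) (simp add: S_def)
  next
    assume le: "Inf S \<le> 1"
    have "Orlicz_integral \<phi> K ((1 / s) *\<^sub>R A) \<le> \<phi> 1" if "1 < s" for s
      using cInf_less_iff[OF \<open>S \<noteq> {}\<close> bdd, of s] le that mono by force
    moreover have "eventually (\<lambda>s. 1 < s) (at_right (1::real))" by (simp add: eventually_at_right_less)
    ultimately have ev: "eventually (\<lambda>s. Orlicz_integral \<phi> K ((1 / s) *\<^sub>R A) \<le> \<phi> 1) (at_right 1)"
      by (rule eventually_mono[rotated])
    have "((\<lambda>s. 1 / s) \<longlongrightarrow> (1::real)) (at_right 1)" by (auto intro!: tendsto_eq_intros)
    from tendsto_upperbound[OF tendsto_Orlicz_integral_scaleR[OF this] ev]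
    show "Orlicz_integral \<phi> K A \<le> \<phi> 1" by simp
  qed
qed

section \<open>Comparison with the linear case, where the Orlicz integral is a norm on
  matrices\<close>

interpretation lin: Orlicz_Legendre_problem K "\<lambda>x. x"
  by unfold_locales (rule K, rule id_in_Phi)

text \<open>Jensen's inequality in the form of a supporting line at 1: integrating it bounds
  \<open>\<phi> 1 + c * (N - 1)\<close> by \<open>\<phi> 1\<close>, where \<open>N\<close> is the
  linear integral and \<open>c > 0\<close>.\<close>

lemma Orlicz_integral_id_le_1:
  assumes "Orlicz_integral \<phi> K A \<le> \<phi> 1"
  shows "Orlicz_integral (\<lambda>x. x) K A \<le> 1"
proof -
  obtain c where c: "c > 0" "\<And>t. 0 \<le> t \<Longrightarrow> \<phi> 1 + c * (t - 1) \<le> \<phi> t"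
    using Phi_supporting_line[OF \<phi>] by blast
  let ?g = "\<lambda>u. radial K u * norm (A *v u)"
  have int: "integrable (dual_vol_measure K) ?g" by (rule lin.integrable_Orlicz_integrand)
  have const: "integrable (dual_vol_measure K) (\<lambda>u. d)" for d :: real
    by (intro integrable_dual_vol_measure K continuous_intros)
  have "(\<integral>u. \<phi> 1 - c + c * ?g u \<partial>dual_vol_measure K) \<le> Orlicz_integral \<phi> K A"
    unfolding Orlicz_integral_def
  proof (intro integral_mono integrable_Orlicz_integrand)
    show "integrable (dual_vol_measure K) (\<lambda>u. \<phi> 1 - c + c * ?g u)"
      by (intro Bochner_Integration.integrable_add const integrable_mult_right int)
    fix u assume "u \<in> space (dual_vol_measure K)"
    then show "\<phi> 1 - c + c * ?g u \<le> \<phi> (?g u)"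
      using c(2)[of "?g u"] radial_norm_nonneg[of u A] by (simp add: space_dual_vol_measure algebra_simps)
  qed
  also have "(\<integral>u. \<phi> 1 - c + c * ?g u \<partial>dual_vol_measure K) =
      (\<integral>u. \<phi> 1 - c \<partial>dual_vol_measure K) + (\<integral>u. c * ?g u \<partial>dual_vol_measure K)"
    by (intro Bochner_Integration.integral_add const integrable_mult_right int)
  also have "\<dots> = \<phi> 1 - c + c * Orlicz_integral (\<lambda>x. x) K A"
    unfolding integral_dual_vol_measure_const[OF K] Orlicz_integral_def by simp
  finally have "c * Orlicz_integral (\<lambda>x. x) K A \<le> c * 1" using assms by simp
  then show ?thesis using c(1) by (simp only: mult_le_cancel_left_pos)
qed

text \<open>By homogeneity it suffices to bound the integral below on the unit sphere of matrices,
  where it attains a minimum. A minimum of 0 would, by full support, give a matrix killing every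
  unit vector, that is, the zero matrix.\<close>

lemma Orlicz_integral_id_coercive:
  "\<exists>m>0. \<forall>A. m * norm A \<le> Orlicz_integral (\<lambda>x. x) K A"
proof -
  let ?N = "Orlicz_integral (\<lambda>x. x) K"
  have "compact (sphere 0 1 :: (real^'n^'n) set)" by (rule compact_sphere)
  moreover have "sphere 0 1 \<noteq> ({} :: (real^'n^'n) set)" by simp
  ultimately obtain A0 where A0: "norm A0 = 1" and min: "\<And>A. norm A = 1 \<Longrightarrow> ?N A0 \<le> ?N A"
    using continuous_attains_inf[OF _ _ lin.continuous_on_Orlicz_integral]
    by (metis dist_0_norm mem_sphere)
  have "?N A0 > 0"
  proof (rule ccontr)
    assume "\<not> ?N A0 > 0"
    then have le: "(\<integral>u. radial K u * norm (A0 *v u) \<partial>dual_vol_measure K) \<le> 0"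
      by (simp add: Orlicz_integral_def)
    have "A0 *v u = 0" if u: "norm u = 1" for u
      using integral_dual_vol_measure_eq_0[OF K lin.continuous_on_Orlicz_integrand radial_norm_nonneg le u]
        radial_pos[OF K u] by simp
    then have "A0 *v axis j 1 = 0" for j by simp
    then have "A0 $ i $ j = 0" for i j
      by (simp add: matrix_vector_mult_basis column_def vec_eq_iff)
    then have "A0 = 0" by (simp add: vec_eq_iff)
    with A0 show False by simp
  qed
  moreover have "?N A0 * norm A \<le> ?N A" for A
  proof (cases "A = 0")
    case True then show ?thesis by (simp add: lin.Orlicz_integral_nonneg)
  next
    case False
    have "?N (r *\<^sub>R B) = r * ?N B" if "0 \<le> r" for r B
      using that by (simp add: Orlicz_integral_def mult.left_commute[of _ r] flip: scaleR_matrix_vector_assoc)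
    from this[of "norm A" "A /\<^sub>R norm A"]
    have "?N (norm A *\<^sub>R (A /\<^sub>R norm A)) = norm A * ?N (A /\<^sub>R norm A)" by simp
    moreover have "?N A0 \<le> ?N (A /\<^sub>R norm A)" using False by (intro min) simp
    ultimately show ?thesis using False by (simp add: mult.commute mult_left_mono)
  qed
  ultimately show ?thesis by blast
qed

section \<open>Existence and uniqueness of the minimal ellipsoid\<close>

lemma exists_max_det:
  obtains A :: "real^'n^'n" where "invertible A" "Orlicz_integral \<phi> K A \<le> \<phi> 1"
    "\<And>B :: real^'n^'n. Orlicz_integral \<phi> K B \<le> \<phi> 1 \<Longrightarrow> \<bar>det B\<bar> \<le> \<bar>det A\<bar>"
proof -
  \<comment> \<open>Singular matrices are kept in \<open>F\<close> so that it is closed; coercivity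
    makes it bounded. The maximizer is invertible because a small multiple of the identity lies in
    \<open>F\<close> and has nonzero determinant.\<close>
  define F where "F = {A :: real^'n^'n. Orlicz_integral \<phi> K A \<le> \<phi> 1}"
  obtain m where m: "m > 0" "\<And>A. m * norm A \<le> Orlicz_integral (\<lambda>x. x) K A"
    using Orlicz_integral_id_coercive by blast
  have "norm A \<le> 1 / m" if "A \<in> F" for A
    using m(2)[of A] Orlicz_integral_id_le_1[of A] that m(1) by (simp add: F_def field_simps)
  then have "bounded F" by (auto simp: bounded_iff)
  moreover have "closed F" unfolding F_def
    by (intro closed_Collect_le continuous_on_Orlicz_integral continuous_intros)
  ultimately have "compact F" by (simp add: compact_eq_bounded_closed)
  obtain M where M: "M > 0" "\<And>u. norm u = 1 \<Longrightarrow> radial K u \<le> M" using radial_bounded by blast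
  have I: "(1 / M) *\<^sub>R mat 1 \<in> F" unfolding F_def
    using M by (auto intro!: Orlicz_integral_le_1I simp flip: scaleR_matrix_vector_assoc)
  obtain A where A: "A \<in> F" "\<And>B. B \<in> F \<Longrightarrow> \<bar>det B\<bar> \<le> \<bar>det A\<bar>"
    using continuous_attains_sup[OF \<open>compact F\<close> _ continuous_on_rabs[OF continuous_on_det]] I by blast
  have "det ((1 / M) *\<^sub>R mat 1 :: real^'n^'n) \<noteq> 0" using M(1) by (simp add: det_scaleR)
  then have "det A \<noteq> 0" using A(2)[OF I] by auto
  then show thesis using A that[of A] by (simp add: F_def invertible_det_nz)
qed

text \<open>The rotated matrix \<open>Q ** B\<close> has the same gauge as \<open>B\<close>, so it
  is feasible too. The midpoint \<open>C\<close> of \<open>A\<close> and \<open>Q ** B\<close> has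
  at least the same determinant, which forces equality in every inequality behind convexity.\<close>

lemma max_det_unique:
  fixes A B :: "real^'n^'n"
  assumes A: "invertible A" "Orlicz_integral \<phi> K A \<le> \<phi> 1"
    and max: "\<And>C :: real^'n^'n. Orlicz_integral \<phi> K C \<le> \<phi> 1 \<Longrightarrow> \<bar>det C\<bar> \<le> \<bar>det A\<bar>"
    and B: "invertible B" "Orlicz_integral \<phi> K B \<le> \<phi> 1" and eq: "\<bar>det B\<bar> = \<bar>det A\<bar>"
  shows "gauge_ellipsoid A = gauge_ellipsoid B"
proof -
  obtain Q where Q: "orthogonal_matrix Q" "2 ^ CARD('n) * \<bar>det A\<bar> \<le> \<bar>det (A + Q ** B)\<bar>"
    using exists_rotation_det_add_ge[OF A(1) B(1) eq] by blast
  have normQ: "norm ((Q ** B) *v u) = norm (B *v u)" for u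
    using Q(1) orthogonal_transformation_norm[of "(*v) Q" "B *v u"]
    by (simp add: orthogonal_transformation_matrix matrix_vector_mul_assoc)
  define C where "C = (1 - 1/2) *\<^sub>R A + (1/2) *\<^sub>R (Q ** B)"
  have C: "C = (1/2) *\<^sub>R (A + Q ** B)" by (simp add: C_def scaleR_add_right)
  have detA: "det A \<noteq> 0" using A(1) invertible_det_nz by blast
  have detC: "\<bar>det A\<bar> \<le> \<bar>det C\<bar>"
    using Q(2) unfolding C det_scaleR abs_mult by (simp add: power_one_over field_simps)
  \<comment> \<open>If \<open>C\<close> were strictly feasible, then by continuity so would be
    \<open>s *\<^sub>R C\<close> for some \<open>s > 1\<close>, whose determinant exceeds the
    maximum.\<close>
  have GC: "\<phi> 1 \<le> Orlicz_integral \<phi> K C"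
  proof (rule ccontr)
    assume "\<not> \<phi> 1 \<le> Orlicz_integral \<phi> K C"
    then have less: "Orlicz_integral \<phi> K C < \<phi> 1" by simp
    have "((\<lambda>s. s) \<longlongrightarrow> (1::real)) (at_right 1)" by (auto intro!: tendsto_eq_intros)
    from order_tendstoD(2)[OF tendsto_Orlicz_integral_scaleR[OF this] less]
    have "eventually (\<lambda>s. Orlicz_integral \<phi> K (s *\<^sub>R C) < \<phi> 1 \<and> 1 < s) (at_right 1)"
      by (intro eventually_conj) (simp_all add: eventually_at_right_less)
    then obtain s :: real where s: "Orlicz_integral \<phi> K (s *\<^sub>R C) < \<phi> 1" "1 < s"
      by (metis (no_types, lifting) eventually_happens' trivial_limit_at_right_real)
    have "1 * \<bar>det A\<bar> < s ^ CARD('n) * \<bar>det A\<bar>"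
      using s(2) detA by (intro mult_strict_right_mono one_less_power) auto
    also have "\<dots> \<le> s ^ CARD('n) * \<bar>det C\<bar>" using s(2) detC by (intro mult_left_mono) auto
    also have "\<dots> = \<bar>det (s *\<^sub>R C)\<bar>" using s(2) by (simp add: det_scaleR abs_mult)
    also have "\<dots> \<le> \<bar>det A\<bar>" using s(1) by (intro max) simp
    finally show False by simp
  qed
  let ?f = "\<lambda>A u. \<phi> (radial K u * norm (A *v u))"
  \<comment> \<open>\<open>h\<close> is the midpoint convexity defect of the integrand: continuous,
    nonnegative, and with integral at most
    \<open>\<phi> 1 / 2 + \<phi> 1 / 2 - \<phi> 1 = 0\<close>. So it vanishes at every unit
    vector.\<close>
  define h where "h u = (1 - 1/2) * ?f A u + 1/2 * ?f (Q ** B) u - ?f C u" for u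
  have h0: "h u = 0" if "norm u = 1" for u
  proof (rule integral_dual_vol_measure_eq_0[OF K _ _ _ that])
    show "continuous_on (sphere 0 1) h" unfolding h_def
      by (intro continuous_intros continuous_on_Orlicz_integrand)
    show "0 \<le> h u" if "norm u = 1" for u
      using Orlicz_integrand_convex[of "1/2" u A "Q ** B"] that by (simp add: h_def C_def)
    have "(\<integral>u. h u \<partial>dual_vol_measure K) =
        (1 - 1/2) * Orlicz_integral \<phi> K A + 1/2 * Orlicz_integral \<phi> K (Q ** B) - Orlicz_integral \<phi> K C"
      unfolding h_def Orlicz_integral_def using integrable_Orlicz_integrand by simp
    also have "Orlicz_integral \<phi> K (Q ** B) = Orlicz_integral \<phi> K B"
      unfolding Orlicz_integral_def normQ ..
    finally show "(\<integral>u. h u \<partial>dual_vol_measure K) \<le> 0" using A(2) B(2) GC by simp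
  qed
  \<comment> \<open>A strict triangle inequality at \<open>u\<close> would, through the strict
    monotonicity of \<open>\<phi>\<close>, make \<open>h u\<close> positive.\<close>
  have unit: "norm (A *v u + (Q ** B) *v u) = norm (A *v u) + norm ((Q ** B) *v u)" if u: "norm u = 1" for u
  proof (rule antisym[OF norm_triangle_ineq], rule ccontr)
    assume "\<not> norm (A *v u) + norm ((Q ** B) *v u) \<le> norm (A *v u + (Q ** B) *v u)"
    then have "norm (C *v u) < (1 - 1/2) * norm (A *v u) + 1/2 * norm ((Q ** B) *v u)"
      unfolding C by (simp add: matrix_vector_mult_add_rdistrib flip: scaleR_matrix_vector_assoc)
    then have "radial K u * norm (C *v u) <
        radial K u * ((1 - 1/2) * norm (A *v u) + 1/2 * norm ((Q ** B) *v u))"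
      using radial_pos[OF K u] by (rule mult_strict_left_mono)
    then have "?f C u < \<phi> ((1 - 1/2) * (radial K u * norm (A *v u)) + 1/2 * (radial K u * norm ((Q ** B) *v u)))"
      by (intro Phi_less[OF \<phi>] radial_norm_nonneg u) (simp add: algebra_simps)
    also have "\<dots> \<le> (1 - 1/2) * ?f A u + 1/2 * ?f (Q ** B) u"
      by (rule Orlicz_integrand_convex(2)) (use u in auto)
    finally show False using h0[OF u] by (simp add: h_def)
  qed
  \<comment> \<open>Equality in the triangle inequality means that the two vectors point in the same
    direction.\<close>
  have par: "norm (A *v v) *\<^sub>R ((Q ** B) *v v) = norm ((Q ** B) *v v) *\<^sub>R (A *v v)" for v
  proof (cases "v = 0")
    case False
    define u where "u = v /\<^sub>R norm v"
    have u: "norm u = 1" "v = norm v *\<^sub>R u" using False by (simp_all add: u_def)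
    have *: "norm (A *v u) *\<^sub>R ((Q ** B) *v u) = norm ((Q ** B) *v u) *\<^sub>R (A *v u)"
      using unit[OF u(1)] unfolding norm_triangle_eq .
    have "X *v v = norm v *\<^sub>R (X *v u)" for X :: "real^'n^'n"
      by (metis u(2) matrix_vector_mult_scaleR)
    with arg_cong[OF *, of "\<lambda>z. (norm v * norm v) *\<^sub>R z"] show ?thesis
      by (simp add: mult_ac)
  qed simp
  obtain A' where A': "A ** A' = mat 1" "A' ** A = mat 1" using A(1) by (auto simp: invertible_def)
  define M where "M = Q ** B ** A'"
  \<comment> \<open>Writing \<open>w = A *v v\<close>, the parallelism of
    \<open>(Q ** B) *v v\<close> and \<open>A *v v\<close> says that \<open>w\<close> is an
    eigenvector of \<open>M\<close>.\<close>
  have "\<exists>c. M *v w = c *\<^sub>R w" for w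
  proof (cases "w = 0")
    case False
    have w: "A *v (A' *v w) = w" by (simp add: matrix_vector_mul_assoc A')
    have "norm w *\<^sub>R (M *v w) = norm (M *v w) *\<^sub>R w"
      using par[of "A' *v w"] by (simp add: w) (simp add: M_def matrix_vector_mul_assoc)
    then have "M *v w = (norm (M *v w) / norm w) *\<^sub>R w"
      using False by (metis divide_inverse_commute norm_eq_zero scaleR_scaleR left_inverse scaleR_one)
    then show ?thesis by blast
  qed simp
  then obtain c where c: "M = c *\<^sub>R mat 1" using matrix_all_eigenvectors_imp_scalar[of M] by blast
  have MA: "M ** A = Q ** B" by (simp add: M_def A' flip: matrix_mul_assoc)
  have "\<bar>det Q\<bar> = 1" using det_orthogonal_matrix[OF Q(1)] by auto
  then have "\<bar>det M\<bar> = 1" using arg_cong[OF MA, of "\<lambda>X. \<bar>det X\<bar>"] eq detA by (simp add: det_mul abs_mult)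
  then have "\<bar>c\<bar> ^ CARD('n) = 1" by (simp add: c det_scaleR power_abs)
  then have "\<bar>c\<bar> = 1" using power_eq_1_iff[of "\<bar>c\<bar>" "CARD('n)"] by auto
  have "norm (A *v x) = norm (B *v x)" for x
  proof -
    have "norm (B *v x) = norm (M *v (A *v x))" using normQ[of x] by (simp add: matrix_vector_mul_assoc MA)
    also have "\<dots> = \<bar>c\<bar> * norm (A *v x)" by (simp add: c flip: scaleR_matrix_vector_assoc)
    finally show ?thesis using \<open>\<bar>c\<bar> = 1\<close> by simp
  qed
  then show ?thesis by (simp add: gauge_ellipsoid_def)
qed

text \<open>\<open>Orlicz_Legendre\<close> is a definite description, so it has the minimizing
  property only once existence and uniqueness are both proved. As volume is inversely proportional
  to \<open>\<bar>det A\<bar>\<close>, minimal volume is maximal determinant.\<close>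

lemma Orlicz_Legendre_is_arg_min:
  "is_arg_min vol (\<lambda>E. E \<in> ellipsoids \<and> Orlicz_functional \<phi> K E \<le> 1) (Orlicz_Legendre \<phi> K)"
proof -
  obtain A :: "real^'n^'n" where A: "invertible A" "Orlicz_integral \<phi> K A \<le> \<phi> 1"
    and max: "\<And>B :: real^'n^'n. Orlicz_integral \<phi> K B \<le> \<phi> 1 \<Longrightarrow> \<bar>det B\<bar> \<le> \<bar>det A\<bar>"
    using exists_max_det by blast
  let ?P = "\<lambda>E. E \<in> ellipsoids \<and> Orlicz_functional \<phi> K E \<le> 1"
  have P: "?P E \<longleftrightarrow> (\<exists>B. invertible B \<and> E = gauge_ellipsoid B \<and> Orlicz_integral \<phi> K B \<le> \<phi> 1)" for E
    using Orlicz_functional_gauge_le_1_iff by (auto simp: ellipsoids_iff_gauge)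
  have ball: "vol (cball (0::real^'n) 1) > 0" by (simp add: content_cball_pos)
  have le_iff: "vol (gauge_ellipsoid A) \<le> vol (gauge_ellipsoid B) \<longleftrightarrow> \<bar>det B\<bar> \<le> \<bar>det A\<bar>"
    if "invertible B" for B :: "real^'n^'n"
  proof -
    have "\<bar>det A\<bar> > 0" "\<bar>det B\<bar> > 0" using A(1) that by (simp_all add: invertible_det_nz)
    then show ?thesis
      using ball by (simp add: vol_gauge_ellipsoid A(1) that field_simps)
  qed
  have A_min: "is_arg_min vol ?P (gauge_ellipsoid A)"
    unfolding is_arg_min_def P using A max le_iff by (metis leD)
  have "E = gauge_ellipsoid A" if E: "is_arg_min vol ?P E" for E
  proof -
    obtain B where B: "invertible B" "E = gauge_ellipsoid B" "Orlicz_integral \<phi> K B \<le> \<phi> 1"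
      using E unfolding is_arg_min_def P by blast
    have "vol E \<le> vol (gauge_ellipsoid A)"
      using E A_min unfolding is_arg_min_def by (metis not_le)
    then have "\<bar>det A\<bar> \<le> \<bar>det B\<bar>"
      using ball A(1) B(1) by (simp add: B(2) vol_gauge_ellipsoid field_simps invertible_det_nz)
    then have "\<bar>det B\<bar> = \<bar>det A\<bar>" using max[OF B(3)] by simp
    with max_det_unique[OF A max B(1,3)] B(2) show ?thesis by simp
  qed
  with A_min show ?thesis unfolding Orlicz_Legendre_def by (rule theI)
qed

section \<open>The volume inequality and its equality case\<close>

lemma vol_le_feasible:
  fixes A :: "real^'n^'n"
  assumes A: "invertible A" and le: "Orlicz_integral \<phi> K A \<le> \<phi> 1"
  shows "vol K \<le> vol (gauge_ellipsoid A)"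
    and "vol (gauge_ellipsoid A) = vol K \<Longrightarrow> K = gauge_ellipsoid A"
proof -
  let ?E = "gauge_ellipsoid A"
  let ?n = "real CARD('n)"
  have E: "?E \<in> star_bodies" using A by (rule gauge_ellipsoid_in_star_bodies)
  define x where "x u = radial K u * norm (A *v u)" for u
  define y where "y u = radial ?E u / radial K u" for u
  have rE: "radial ?E u = 1 / norm (A *v u)" if "norm u = 1" for u
    using that by (intro radial_gauge_ellipsoid A) auto
  have pos: "y u > 0" and xy: "x u = 1 / y u" if "norm u = 1" for u
    using radial_pos[OF K that] radial_pos[OF E that] by (simp_all add: x_def y_def rE[OF that])
  have cx: "continuous_on (sphere 0 1) x"
    unfolding x_def by (rule lin.continuous_on_Orlicz_integrand)
  have cy: "continuous_on (sphere 0 1) (\<lambda>u. y u ^ CARD('n))"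
    unfolding y_def using radial_pos[OF K]
    by (intro continuous_intros continuous_on_radial K E) force
  have ix: "integrable (dual_vol_measure K) x" and iy: "integrable (dual_vol_measure K) (\<lambda>u. y u ^ CARD('n))"
    using cx cy by (auto intro: integrable_dual_vol_measure K)
  \<comment> \<open>The polar volume formula is available as a nonnegative integral; finiteness and
    nonnegativity bring it back to the reals.\<close>
  have "ennreal (\<integral>u. y u ^ CARD('n) \<partial>dual_vol_measure K) = ennreal (vol ?E / vol K)"
    unfolding nn_integral_radial_ratio[OF K E, symmetric] y_def[symmetric]
    by (intro nn_integral_eq_integral[symmetric] iy AE_I2)
      (use pos in \<open>auto simp: space_dual_vol_measure less_imp_le\<close>)
  moreover have "0 \<le> (\<integral>u. y u ^ CARD('n) \<partial>dual_vol_measure K)"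
    by (intro Bochner_Integration.integral_nonneg_AE AE_I2)
      (use pos in \<open>auto simp: space_dual_vol_measure less_imp_le\<close>)
  ultimately have int_y: "(\<integral>u. y u ^ CARD('n) \<partial>dual_vol_measure K) = vol ?E / vol K"
    using vol_star_body_pos[OF K] vol_star_body_pos[OF E] by (simp add: ennreal_inj)
  have int_x: "(\<integral>u. x u \<partial>dual_vol_measure K) \<le> 1"
    using Orlicz_integral_id_le_1[OF le] by (simp add: Orlicz_integral_def x_def)
  \<comment> \<open>The defect in \<open>y\<^sup>n \<ge> 1 + n * (1 - 1 / y)\<close>, with
    \<open>x = 1 / y\<close>.\<close>
  define h where "h u = y u ^ CARD('n) - (1 + ?n) + ?n * x u" for u
  \<comment> \<open>Bernoulli's inequality gives \<open>h \<ge> n * (y - 2 + 1 / y)\<close>, and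
    this remainder is the stated square. It is kept in explicit form so that \<open>h u = 0\<close>
    forces \<open>y u = 1\<close>.\<close>
  have h: "?n * (y u - 1)\<^sup>2 / y u \<le> h u" if "norm u = 1" for u
  proof -
    have "1 + ?n * (y u - 1) \<le> (1 + (y u - 1)) ^ CARD('n)"
      using pos[OF that] by (intro Bernoulli_inequality) simp
    moreover have "(y u - 1)\<^sup>2 / y u = y u - 2 + x u"
      using pos[OF that] by (simp add: xy[OF that] power2_eq_square field_simps)
    then have "?n * (y u - 1)\<^sup>2 / y u = ?n * (y u - 2 + x u)"
      by (metis times_divide_eq_right)
    ultimately show ?thesis by (simp add: h_def algebra_simps)
  qed
  have h_nonneg: "0 \<le> h u" if "norm u = 1" for u
    using h[OF that] pos[OF that] by (intro order_trans[OF _ h[OF that]]) simp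
  have const: "integrable (dual_vol_measure K) (\<lambda>u. d)" for d :: real
    by (intro integrable_dual_vol_measure K continuous_intros)
  have int_h: "(\<integral>u. h u \<partial>dual_vol_measure K) = vol ?E / vol K - (1 + ?n) + ?n * (\<integral>u. x u \<partial>dual_vol_measure K)"
  proof -
    have "(\<integral>u. h u \<partial>dual_vol_measure K) = (\<integral>u. y u ^ CARD('n) \<partial>dual_vol_measure K)
        - (\<integral>u. 1 + ?n \<partial>dual_vol_measure K) + (\<integral>u. ?n * x u \<partial>dual_vol_measure K)"
      unfolding h_def
      by (subst Bochner_Integration.integral_add Bochner_Integration.integral_diff,
          intro Bochner_Integration.integrable_diff iy const, intro integrable_mult_right ix)
        (subst Bochner_Integration.integral_diff, rule iy, rule const, rule refl)
    then show ?thesis unfolding int_y integral_dual_vol_measure_const[OF K] by simp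
  qed
  have nx: "?n * (\<integral>u. x u \<partial>dual_vol_measure K) \<le> ?n" using int_x by (simp add: mult_left_le)
  have "0 \<le> (\<integral>u. h u \<partial>dual_vol_measure K)"
    by (intro Bochner_Integration.integral_nonneg_AE AE_I2)
      (auto simp: space_dual_vol_measure h_nonneg)
  \<comment> \<open>Since the integral of \<open>x\<close> is at most 1, the integral of
    \<open>h\<close> is at most \<open>vol ?E / vol K - 1\<close>. This gives the inequality here
    and a nonpositive integral of \<open>h\<close> when the volumes agree.\<close>
  then have "1 \<le> vol ?E / vol K" using int_h nx by linarith
  then show "vol K \<le> vol ?E" using vol_star_body_pos[OF K] by (simp add: field_simps)
  assume "vol ?E = vol K"
  then have le0: "(\<integral>u. h u \<partial>dual_vol_measure K) \<le> 0"
    using int_h nx vol_star_body_pos[OF K] by simp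
  have ch: "continuous_on (sphere 0 1) h" unfolding h_def by (intro continuous_intros cx cy)
  show "K = ?E"
  proof (rule star_body_eqI[OF K E])
    fix u :: "real^'n" assume u: "norm u = 1"
    have "h u = 0" by (rule integral_dual_vol_measure_eq_0[OF K ch h_nonneg le0 u])
    then have "?n * (y u - 1)\<^sup>2 / y u \<le> 0" using h[OF u] by simp
    then have "y u = 1" using pos[OF u] by (simp add: divide_le_0_iff mult_le_0_iff)
    then show "radial K u = radial ?E u" using radial_pos[OF K u] by (simp add: y_def)
  qed
qed

text \<open>For \<open>K\<close> itself the argument of \<open>\<phi>\<close> is identically 1. This
  makes an ellipsoid \<open>K\<close> a competitor in its own minimization problem.\<close>

lemma feasible_self:
  assumes "K \<in> ellipsoids"
  shows "Orlicz_functional \<phi> K K \<le> 1"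
proof -
  obtain A where A: "invertible A" "K = gauge_ellipsoid A" using assms by (auto simp: ellipsoids_iff_gauge)
  have "Orlicz_integral \<phi> K A \<le> \<phi> 1"
  proof (rule Orlicz_integral_le_1I)
    fix u :: "real^'n" assume "norm u = 1"
    then have "u \<noteq> 0" by auto
    then show "radial K u * norm (A *v u) \<le> 1"
      using radial_gauge_ellipsoid[OF A(1), of u] by (simp add: A(2))
  qed
  then show ?thesis using Orlicz_functional_gauge_le_1_iff[OF A(1)] A(2) by simp
qed

end

theorem theorem8p2:
  fixes K :: "(real ^ 'n) set" and \<phi> :: "real \<Rightarrow> real"
  assumes "K \<in> star_bodies" and "\<phi> \<in> Phi"
  shows "vol (Orlicz_Legendre \<phi> K) \<ge> vol K \<and>
         (vol (Orlicz_Legendre \<phi> K) = vol K \<longleftrightarrow> K \<in> ellipsoids)"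
proof -
  interpret Orlicz_Legendre_problem K \<phi> by unfold_locales fact+
  let ?L = "Orlicz_Legendre \<phi> K"
  have L: "?L \<in> ellipsoids" "Orlicz_functional \<phi> K ?L \<le> 1"
    and min: "\<And>E. E \<in> ellipsoids \<Longrightarrow> Orlicz_functional \<phi> K E \<le> 1 \<Longrightarrow> vol ?L \<le> vol E"
    using Orlicz_Legendre_is_arg_min unfolding is_arg_min_def by (auto simp: not_less)
  obtain A where A: "invertible A" "?L = gauge_ellipsoid A" using L(1) by (auto simp: ellipsoids_iff_gauge)
  then have "Orlicz_integral \<phi> K A \<le> \<phi> 1" using L(2) Orlicz_functional_gauge_le_1_iff by simp
  from vol_le_feasible[OF A(1) this] have ge: "vol K \<le> vol ?L" and eq: "vol ?L = vol K \<Longrightarrow> K = ?L"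
    by (simp_all flip: A(2))
  \<comment> \<open>An ellipsoid \<open>K\<close> is feasible, so minimality gives the reverse
    inequality. Conversely, equal volumes give \<open>K = ?L\<close>, which is an ellipsoid.\<close>
  have "vol ?L = vol K" if "K \<in> ellipsoids"
    using min[OF that feasible_self[OF that]] ge by simp
  with ge eq L(1) show ?thesis by metis
qed

end
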